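(* The lattice $\mathfrak L(\mathbf R\vee\mathbf R^\delta)$ of subvarieties of $\mathbf R\vee\mathbf R^\delta$ consists of exactly the following $11$ pairwise distinct varieties: \[\mathbf T,\ \mathbf{SL},\ \mathbf C_2,\ \mathbf C_3,\ \mathbf D,\ \mathbf D_2,\ \mathbf D\vee\mathbf C_3,\ \mathbf D_2\vee\mathbf C_3,\ \mathbf R,\ \mathbf R^\delta,\ \mathbf R\vee\mathbf R^\delta,\] and its covering relations (where $\mathbf A\prec\mathbf B$ means that $\mathbf B$ covers $\mathbf A$ with respect to inclusion) are exactly \begin{align*} &\mathbf T\prec\mathbf{SL},\quad \mathbf{SL}\prec\mathbf C_2,\quad \mathbf C_2\prec\mathbf D,\quad \mathbf C_2\prec\mathbf C_3,\quad \mathbf D\prec\mathbf D_2,\\ &\mathbf D\prec\mathbf D\vee\mathbf C_3,\quad \mathbf C_3\prec\mathbf D\vee\mathbf C_3,\quad \mathbf D_2\prec\mathbf D_2\vee\mathbf C_3,\\ &\mathbf D\vee\mathbf C_3\prec\mathbf D_2\vee\mathbf C_3,\quad \mathbf D\vee\mathbf C_3\prec\mathbf R,\quad \mathbf D\vee\mathbf C_3\prec\mathbf R^\delta,\\ &\mathbf D_2\vee\mathbf C_3\prec\mathbf R\vee\mathbf R^\delta,\quad \mathbf R\prec\mathbf R\vee\mathbf R^\delta,\quad \mathbf R^\delta\prec\mathbf R\vee\mathbf R^\delta. \end{align*} In particular, this lattice is modular but not distributive.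
   Context: Monoids are considered as semigroups with an identity element that is fixed by a 0-ary operation, and a monoid variety is a class of monoids definable by identities between (possibly empty) words. Varieties are ordered by inclusion; $\mathbf A\vee\mathbf B$ is the smallest monoid variety containing both $\mathbf A$ and $\mathbf B$. For a monoid variety $\mathbf V$, $\mathfrak L(\mathbf V)$ is the lattice of all monoid varieties contained in $\mathbf V$. For an identity system $\Sigma$, $\operatorname{var}\Sigma$ is the variety of monoids defined by $\Sigma$. $\mathbf T$ is the variety of trivial monoids, $\mathbf{SL}$ is the variety of semilattice monoids (commutative idempotent monoids), and for $n\ge 2$ \[\mathbf C_n=\operatorname{var}\{x^n\approx x^{n+1},\ xy\approx yx\};\qquad \mathbf D=\operatorname{var}\{x^2\approx x^3,\ x^2y\approx xyx\approx yx^2\}.\] $\mathbf D_2$ is the monoid variety generated by the monoid \[\langle a,b,1\mid a^2=b^2=bab=0\rangle=\{a,b,ab,ba,aba,1,0\},\] and $\mathbf R$ is the monoid variety generated by the monoid \[\langle a,b,1\mid a^3=b^2=ba=0\rangle=\{a,b,a^2,ab,a^2b,1,0\},\] where in both presentations $1$ is the identity element and $0$ is a zero element. $\mathbf R^\delta$ is the variety dual to $\mathbf R$, that is, the variety consisting of the opposite monoids of the members of $\mathbf R$. *)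

theory Defs
  imports "HOL-Algebra.Lattice" "HOL-Algebra.Group" "HOL-Library.Sublist"
begin

section \<open>Identities and monoid varieties\<close>

text \<open>
  Words are lists over a countably infinite alphabet of variables; the empty word is allowed.
  An identity is a pair of words.
\<close>

type_synonym word = "nat list"
type_synonym identity = "word \<times> word"

definition word_value :: "('a, 'm) monoid_scheme \<Rightarrow> (nat \<Rightarrow> 'a) \<Rightarrow> word \<Rightarrow> 'a" where
  "word_value M \<phi> w = foldr (\<otimes>\<^bsub>M\<^esub>) (map \<phi> w) \<one>\<^bsub>M\<^esub>"

definition satisfies :: "('a, 'm) monoid_scheme \<Rightarrow> identity \<Rightarrow> bool" where
  "satisfies M e \<longleftrightarrow>
     (\<forall>\<phi>. (\<forall>i. \<phi> i \<in> carrier M) \<longrightarrow> word_value M \<phi> (fst e) = word_value M \<phi> (snd e))"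

text \<open>
  HOL has no proper classes, so a class of monoids is a set of monoids whose carriers are subsets
  of a type \<open>'a\<close>. If \<open>'a\<close> is infinite, it has room for all countable monoids up to isomorphism,
  in particular for the free objects of countable rank of every variety, so that different
  varieties have different sets of members inside \<open>'a\<close>.
\<close>

definition var :: "identity set \<Rightarrow> 'a monoid set" where
  "var \<Sigma> = {M. monoid M \<and> (\<forall>e\<in>\<Sigma>. satisfies M e)}"

definition variety :: "'a monoid set \<Rightarrow> bool" where
  "variety V \<longleftrightarrow> (\<exists>\<Sigma>. V = var \<Sigma>)"

text \<open>
  The generating monoid may live on a type other than \<open>'a\<close>; membership in a variety is
  therefore expressed through an isomorphic copy.
\<close>

definition generated_variety :: "'b monoid \<Rightarrow> 'a monoid set" where
  "generated_variety M = \<Inter>{V. variety V \<and> (\<exists>N\<in>V. M \<cong> N)}"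

definition variety_join :: "'a monoid set \<Rightarrow> 'a monoid set \<Rightarrow> 'a monoid set"
    (infixl \<open>\<or>\<^sub>v\<close> 65) where
  "A \<or>\<^sub>v B = \<Inter>{V. variety V \<and> A \<subseteq> V \<and> B \<subseteq> V}"

definition opposite :: "'a monoid \<Rightarrow> 'a monoid" where
  "opposite M = M\<lparr>mult := (\<lambda>x y. y \<otimes>\<^bsub>M\<^esub> x)\<rparr>"

definition dual_variety :: "'a monoid set \<Rightarrow> 'a monoid set" where
  "dual_variety V = opposite ` V"


section \<open>Subvariety lattices\<close>

definition subvariety_lattice :: "'a monoid set \<Rightarrow> 'a monoid set gorder" where
  "subvariety_lattice V = \<lparr>carrier = {W. variety W \<and> W \<subseteq> V}, eq = (=), le = (\<subseteq>)\<rparr>"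

definition covering_relation :: "('c, 'm) gorder_scheme \<Rightarrow> ('c \<times> 'c) set" where
  "covering_relation L =
     {(A, B). A \<in> carrier L \<and> B \<in> carrier L \<and> A \<sqsubset>\<^bsub>L\<^esub> B \<and>
              \<not> (\<exists>C\<in>carrier L. A \<sqsubset>\<^bsub>L\<^esub> C \<and> C \<sqsubset>\<^bsub>L\<^esub> B)}"

definition modular_lattice :: "('c, 'm) gorder_scheme \<Rightarrow> bool" where
  "modular_lattice L \<longleftrightarrow> lattice L \<and>
     (\<forall>x\<in>carrier L. \<forall>y\<in>carrier L. \<forall>z\<in>carrier L. x \<sqsubseteq>\<^bsub>L\<^esub> z \<longrightarrow>
        x \<squnion>\<^bsub>L\<^esub> (y \<sqinter>\<^bsub>L\<^esub> z) = (x \<squnion>\<^bsub>L\<^esub> y) \<sqinter>\<^bsub>L\<^esub> z)"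

definition distributive_lattice :: "('c, 'm) gorder_scheme \<Rightarrow> bool" where
  "distributive_lattice L \<longleftrightarrow> lattice L \<and>
     (\<forall>x\<in>carrier L. \<forall>y\<in>carrier L. \<forall>z\<in>carrier L.
        x \<sqinter>\<^bsub>L\<^esub> (y \<squnion>\<^bsub>L\<^esub> z) = (x \<sqinter>\<^bsub>L\<^esub> y) \<squnion>\<^bsub>L\<^esub> (x \<sqinter>\<^bsub>L\<^esub> z))"


section \<open>Presentations of monoids with zero\<close>

text \<open>
  \<open>'g list option\<close> is the free monoid over the letters of type \<open>'g\<close> with a zero \<open>None\<close> adjoined.
  The monoid presented by \<open>R\<close> is its quotient by the congruence generated by \<open>R\<close>.
\<close>

type_synonym 'g zword = "'g list option"

fun zmult :: "'g zword \<Rightarrow> 'g zword \<Rightarrow> 'g zword" where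
  "zmult (Some u) (Some v) = Some (u @ v)"
| "zmult _ _ = None"

inductive_set generated_congruence :: "('g zword \<times> 'g zword) set \<Rightarrow> ('g zword \<times> 'g zword) set"
  for R where
  base: "(u, v) \<in> R \<Longrightarrow> (u, v) \<in> generated_congruence R"
| refl: "(u, u) \<in> generated_congruence R"
| sym: "(u, v) \<in> generated_congruence R \<Longrightarrow> (v, u) \<in> generated_congruence R"
| trans: "(u, v) \<in> generated_congruence R \<Longrightarrow> (v, w) \<in> generated_congruence R \<Longrightarrow>
    (u, w) \<in> generated_congruence R"
| mult: "(u, u') \<in> generated_congruence R \<Longrightarrow> (v, v') \<in> generated_congruence R \<Longrightarrow>
    (zmult u v, zmult u' v') \<in> generated_congruence R"

definition presented_monoid :: "('g zword \<times> 'g zword) set \<Rightarrow> 'g zword set monoid" where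
  "presented_monoid R =
     \<lparr>carrier = UNIV // generated_congruence R,
      mult = (\<lambda>X Y. \<Union>u\<in>X. \<Union>v\<in>Y. generated_congruence R `` {zmult u v}),
      one = generated_congruence R `` {Some []}\<rparr>"

datatype letter = La | Lb

definition D2_monoid :: "letter zword set monoid" where
  "D2_monoid = presented_monoid
     {(Some [La, La], None), (Some [Lb, Lb], None), (Some [Lb, La, Lb], None)}"

definition R_monoid :: "letter zword set monoid" where
  "R_monoid = presented_monoid
     {(Some [La, La, La], None), (Some [Lb, Lb], None), (Some [Lb, La], None)}"


section \<open>The varieties\<close>

definition var_T :: "'a monoid set" where
  "var_T = {M. monoid M \<and> carrier M = {\<one>\<^bsub>M\<^esub>}}"

definition var_SL :: "'a monoid set" where
  "var_SL = {M. comm_monoid M \<and> (\<forall>x\<in>carrier M. x \<otimes>\<^bsub>M\<^esub> x = x)}"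

text \<open>In the identities below, \<open>x\<close> is the variable \<open>0\<close> and \<open>y\<close> is the variable \<open>1\<close>.\<close>

definition var_C :: "nat \<Rightarrow> 'a monoid set" where
  "var_C n = var {(replicate n 0, replicate (n + 1) 0), ([0, 1], [1, 0])}"

definition var_D :: "'a monoid set" where
  "var_D = var {([0, 0], [0, 0, 0]), ([0, 0, 1], [0, 1, 0]), ([0, 1, 0], [1, 0, 0])}"

definition var_D2 :: "'a monoid set" where
  "var_D2 = generated_variety D2_monoid"

definition var_R :: "'a monoid set" where
  "var_R = generated_variety R_monoid"


section \<open>The elements of the two generating monoids\<close>

context
  fixes W :: "'g list set" and R :: "('g zword \<times> 'g zword) set"
  assumes R: "R = (\<lambda>w. (Some w, None)) ` W"
begin

private fun nf :: "'g zword \<Rightarrow> 'g zword" where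
  "nf None = None"
| "nf (Some u) = (if \<exists>w\<in>W. sublist w u then None else Some u)"

private lemma nf_mult: "nf (zmult u v) = nf (zmult (nf u) (nf v))"
  by (cases u; cases v) (auto simp: sublist_append)

private lemma zmult_assoc: "zmult (zmult u v) w = zmult u (zmult v w)"
  by (cases u; cases v; cases w) auto

private lemma nf_cong: "(u, nf u) \<in> generated_congruence R"
proof (cases u)
  case (Some x)
  have "(Some x, None) \<in> generated_congruence R" if "w \<in> W" and sl: "sublist w x" for w
  proof -
    obtain p s where x: "x = p @ w @ s" using sl by (auto simp: sublist_def)
    have "(Some w, None) \<in> generated_congruence R"
      using that by (auto simp: R intro: generated_congruence.base)
    from generated_congruence.mult[OF generated_congruence.refl[of "Some p"]
        generated_congruence.mult[OF this generated_congruence.refl[of "Some s"]]]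
    show ?thesis by (simp add: x)
  qed
  then show ?thesis using Some by (auto intro: generated_congruence.refl)
qed (auto intro: generated_congruence.refl)

private lemma generated_congruence_iff: "(u, v) \<in> generated_congruence R \<longleftrightarrow> nf u = nf v"
proof
  show "nf u = nf v" if "(u, v) \<in> generated_congruence R"
    using that
  proof induction
    case (base u v)
    then show ?case by (auto simp: R)
  next
    case (mult u u' v v')
    then show ?case by (metis nf_mult)
  qed auto
  show "(u, v) \<in> generated_congruence R" if "nf u = nf v"
    using that nf_cong by (metis generated_congruence.sym generated_congruence.trans)
qed

lemma presented_monoid_mult_class:
  "(generated_congruence R `` {u}) \<otimes>\<^bsub>presented_monoid R\<^esub> (generated_congruence R `` {v}) =
     generated_congruence R `` {zmult u v}"
proof -
  let ?C = "generated_congruence R"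
  have "?C `` {zmult u' v'} = ?C `` {zmult u v}" if "u' \<in> ?C `` {u}" "v' \<in> ?C `` {v}" for u' v'
  proof -
    have "(zmult u v, zmult u' v') \<in> ?C"
      using that by (blast intro: generated_congruence.mult)
    then show ?thesis by (blast intro: generated_congruence.sym generated_congruence.trans)
  qed
  then have "(\<Union>u'\<in>?C `` {u}. \<Union>v'\<in>?C `` {v}. ?C `` {zmult u' v'}) =
      (\<Union>u'\<in>?C `` {u}. \<Union>v'\<in>?C `` {v}. ?C `` {zmult u v})" by (intro SUP_cong) auto
  also have "\<dots> = ?C `` {zmult u v}"
    by (blast intro: generated_congruence.refl)
  finally show ?thesis by (simp add: presented_monoid_def)
qed

lemma monoid_presented_monoid: "monoid (presented_monoid R)"
proof -
  have carr: "carrier (presented_monoid R) = range (\<lambda>u. generated_congruence R `` {u})"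
    by (auto simp: presented_monoid_def quotient_def)
  have one: "\<one>\<^bsub>presented_monoid R\<^esub> = generated_congruence R `` {Some []}"
    by (simp add: presented_monoid_def)
  have [simp]: "zmult (Some []) u = u" "zmult u (Some []) = u" for u :: "'g zword"
    by (cases u; simp)+
  show ?thesis
    by unfold_locales (auto simp: carr one presented_monoid_mult_class zmult_assoc)
qed

lemma carrier_presented_monoid:
  "carrier (presented_monoid R) =
     (\<lambda>u. generated_congruence R `` {u}) ` insert None (Some ` {u. \<not> (\<exists>w\<in>W. sublist w u)})"
  (is "_ = ?f ` ?N")
proof -
  have N: "nf u \<in> ?N" for u by (cases u) auto
  have "?f u \<in> ?f ` ?N" for u
  proof (rule image_eqI)
    show "?f u = ?f (nf u)"
      using nf_cong[of u] by (blast intro: generated_congruence.sym generated_congruence.trans)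
  qed (rule N)
  then have "range ?f = ?f ` ?N" by blast
  moreover have "carrier (presented_monoid R) = range ?f"
    by (auto simp: presented_monoid_def quotient_def)
  ultimately show ?thesis by simp
qed

lemma inj_on_generated_congruence:
  "inj_on (\<lambda>u. generated_congruence R `` {u}) (insert None (Some ` {u. \<not> (\<exists>w\<in>W. sublist w u)}))"
proof (rule inj_onI)
  fix u v assume uv: "u \<in> insert None (Some ` {u. \<not> (\<exists>w\<in>W. sublist w u)})"
    "v \<in> insert None (Some ` {u. \<not> (\<exists>w\<in>W. sublist w u)})"
    and eq: "generated_congruence R `` {u} = generated_congruence R `` {v}"
  have "v \<in> generated_congruence R `` {u}"
    unfolding eq by (auto intro: generated_congruence.refl)
  then show "u = v" using uv by (auto simp: generated_congruence_iff)
qed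

end

lemma D2_words:
  "{u. \<not> (\<exists>w\<in>{[La, La], [Lb, Lb], [Lb, La, Lb]}. sublist w u)} =
     {[], [La], [Lb], [La, Lb], [Lb, La], [La, Lb, La]}" (is "{u. ?P u} = ?N")
proof -
  have "?P u \<Longrightarrow> u \<in> ?N" for u
  proof (induction u)
    case (Cons c u)
    then have "u \<in> ?N" by (simp add: sublist_Cons_right)
    with Cons.prems show ?case by (cases c) (auto simp: sublist_Cons_right)
  qed simp
  moreover have "u \<in> ?N \<Longrightarrow> ?P u" for u by (auto simp: sublist_Cons_right)
  ultimately show ?thesis by blast
qed

lemma R_words:
  "{u. \<not> (\<exists>w\<in>{[La, La, La], [Lb, Lb], [Lb, La]}. sublist w u)} =
     {[], [La], [Lb], [La, La], [La, Lb], [La, La, Lb]}" (is "{u. ?P u} = ?N")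
proof -
  have "?P u \<Longrightarrow> u \<in> ?N" for u
  proof (induction u)
    case (Cons c u)
    then have "u \<in> ?N" by (simp add: sublist_Cons_right)
    with Cons.prems show ?case by (cases c) (auto simp: sublist_Cons_right)
  qed simp
  moreover have "u \<in> ?N \<Longrightarrow> ?P u" for u by (auto simp: sublist_Cons_right)
  ultimately show ?thesis by blast
qed

lemma D2_monoid_elements:
  defines "cls \<equiv> \<lambda>u. generated_congruence
     {(Some [La, La], None), (Some [Lb, Lb], None), (Some [Lb, La, Lb], None)} `` {u}"
  shows "monoid D2_monoid"
    and "carrier D2_monoid = cls ` {Some [La], Some [Lb], Some [La, Lb], Some [Lb, La],
           Some [La, Lb, La], Some [], None}"
    and "card (carrier D2_monoid) = 7"
proof -
  let ?W = "{[La, La], [Lb, Lb], [Lb, La, Lb]}"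
  let ?E = "{Some [La], Some [Lb], Some [La, Lb], Some [Lb, La], Some [La, Lb, La], Some [], None}"
  have R: "{(Some [La, La], None), (Some [Lb, Lb], None), (Some [Lb, La, Lb], None)} =
      (\<lambda>w. (Some w, None :: letter zword)) ` ?W" by simp
  have E: "insert None (Some ` {u. \<not> (\<exists>w\<in>?W. sublist w u)}) = ?E"
    unfolding D2_words by auto
  show "monoid D2_monoid"
    unfolding D2_monoid_def by (rule monoid_presented_monoid[OF R])
  show c: "carrier D2_monoid = cls ` ?E"
    unfolding D2_monoid_def cls_def carrier_presented_monoid[OF R] E ..
  have "inj_on cls ?E"
    unfolding cls_def by (rule inj_on_generated_congruence[OF R, unfolded E])
  then show "card (carrier D2_monoid) = 7"
    unfolding c by (simp only: card_image) simp
qed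

lemma R_monoid_elements:
  defines "cls \<equiv> \<lambda>u. generated_congruence
     {(Some [La, La, La], None), (Some [Lb, Lb], None), (Some [Lb, La], None)} `` {u}"
  shows "monoid R_monoid"
    and "carrier R_monoid = cls ` {Some [La], Some [Lb], Some [La, La], Some [La, Lb],
           Some [La, La, Lb], Some [], None}"
    and "card (carrier R_monoid) = 7"
proof -
  let ?W = "{[La, La, La], [Lb, Lb], [Lb, La]}"
  let ?E = "{Some [La], Some [Lb], Some [La, La], Some [La, Lb], Some [La, La, Lb], Some [], None}"
  have R: "{(Some [La, La, La], None), (Some [Lb, Lb], None), (Some [Lb, La], None)} =
      (\<lambda>w. (Some w, None :: letter zword)) ` ?W" by simp
  have E: "insert None (Some ` {u. \<not> (\<exists>w\<in>?W. sublist w u)}) = ?E"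
    unfolding R_words by auto
  show "monoid R_monoid"
    unfolding R_monoid_def by (rule monoid_presented_monoid[OF R])
  show c: "carrier R_monoid = cls ` ?E"
    unfolding R_monoid_def cls_def carrier_presented_monoid[OF R] E ..
  have "inj_on cls ?E"
    unfolding cls_def by (rule inj_on_generated_congruence[OF R, unfolded E])
  then show "card (carrier R_monoid) = 7"
    unfolding c by (simp only: card_image) simp
qed

end

theory Submission
  imports Defs
begin

text \<open>
  Every variety in question is determined by its identities, so the subvarieties of
  \<open>\<^bold>R \<or> \<^bold>R\<^sup>\<delta>\<close> correspond, with the order reversed, to the equational theories (fully invariant
  congruences on words) that contain the identities of \<open>\<^bold>R \<or> \<^bold>R\<^sup>\<delta>\<close>.

  The generators of \<open>\<^bold>R\<close> and \<open>\<^bold>D\<^sub>2\<close> are monoids of words with a zero in which every nonzero element is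
  a word of length at most 3 and not a cube of a letter. If a substitution gives a word \<open>u\<close> a nonzero
  value, then the letters with nonempty values form a projection of \<open>u\<close> that is itself that short.
  Hence an identity whose two sides have the same short projections (a rigid identity) holds in
  these monoids, and by symmetry in \<open>\<^bold>R\<^sup>\<delta>\<close>.

  Modulo the rigid identities a word is described by the sequence of its simple letters (those that
  occur once), the set of letters that occur at least three times, and, for every letter \<open>x\<close> that
  occurs exactly twice, the relative positions \<open>xxt\<close>, \<open>xtx\<close> or \<open>txx\<close> of \<open>x\<close> and each simple letter
  \<open>t\<close>. A larger theory can only forget parts of this description, and each way of forgetting is
  expressed by an identity in at most two letters. Seven such identities, the laws, suffice: a theory
  that contains the rigid identities is determined by the laws in it (\<open>theory_le\<close>). The proof deletes
  a nonsimple letter \<open>x\<close> from both sides of an identity, and puts it back by substituting \<open>tx\<close> for the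
  simple letter \<open>t\<close> behind which \<open>x\<close> has to stand; full invariance makes this step harmless.

  The sets of laws that occur are those closed under a few implications, and there are eleven of them
  (\<open>closed_laws_iff\<close>). Each is the set of laws of one of the eleven varieties: for those that are not
  joins, derivations of some laws and small monoids refuting others leave one closed set only, and the
  laws of a join are the common laws of its parts. So the lattice is anti-isomorphic to these eleven
  sets under inclusion, where the join of two varieties corresponds to the intersection of their sets
  of laws and the meet to the closure of the union. The covering relations are then a finite
  computation. The last three laws identify two of the words \<open>xxt\<close>, \<open>xtx\<close>, \<open>txx\<close> each, so the
  interval between \<open>\<^bold>D \<or> \<^bold>C\<^sub>3\<close> and \<open>\<^bold>R \<or> \<^bold>R\<^sup>\<delta>\<close> is the partition lattice of a set with
  three elements, which is modular and not distributive; the other laws only interact through implications with a single premise, which do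
  not disturb modularity (\<open>closed_laws_modular\<close>).
\<close>

section \<open>Identities that preserve short projections\<close>

text \<open>
  A cube of a letter is excluded because in the monoids considered below the third power of a single
  letter is zero: three occurrences carry no more information than four.
\<close>
definition rigid :: "'b list \<Rightarrow> bool" where
  "rigid w \<longleftrightarrow> length w \<le> 3 \<and> \<not> (\<exists>x. w = [x, x, x])"

definition rigid_identities :: "identity set" where
  "rigid_identities =
     {(u, v). \<forall>P. rigid (filter P u) \<or> rigid (filter P v) \<longrightarrow> filter P u = filter P v}"

lemma rigid_identitiesI:
  assumes "\<And>P. filter P u = filter P v \<or> \<not> rigid (filter P u) \<and> \<not> rigid (filter P v)"
  shows "(u, v) \<in> rigid_identities"
proof -
  have "filter P u = filter P v" if "rigid (filter P u) \<or> rigid (filter P v)" for P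
    using assms[of P] that by (elim disjE conjE) simp_all
  then show ?thesis by (simp add: rigid_identities_def)
qed

lemma rigid_identitiesD:
  assumes "(u, v) \<in> rigid_identities" "rigid (filter P u) \<or> rigid (filter P v)"
  shows "filter P u = filter P v"
  using assms unfolding rigid_identities_def by blast

lemma rigid_identities_filter:
  "(u, v) \<in> rigid_identities \<Longrightarrow> (filter P u, filter P v) \<in> rigid_identities"
proof -
  assume uv: "(u, v) \<in> rigid_identities"
  have "filter Q (filter P u) = filter Q (filter P v)
      \<or> \<not> rigid (filter Q (filter P u)) \<and> \<not> rigid (filter Q (filter P v))" for Q
    using rigid_identitiesD[OF uv, of "\<lambda>x. P x \<and> Q x"] unfolding filter_filter by blast
  then show "(filter P u, filter P v) \<in> rigid_identities" by (rule rigid_identitiesI)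
qed

lemma rigid_identities_sym: "(u, v) \<in> rigid_identities \<Longrightarrow> (v, u) \<in> rigid_identities"
  by (rule rigid_identitiesI) (metis rigid_identitiesD)

lemma rigid_rev [simp]: "rigid (rev w) \<longleftrightarrow> rigid w"
proof -
  have "rev w = [x, x, x] \<longleftrightarrow> w = [x, x, x]" for x by (simp add: rev_swap)
  then show ?thesis by (simp add: rigid_def)
qed

lemma rigid_identities_rev: "(u, v) \<in> rigid_identities \<Longrightarrow> (rev u, rev v) \<in> rigid_identities"
  by (rule rigid_identitiesI) (metis rigid_identitiesD rev_filter rigid_rev)

lemma filter_eq_replicate: "filter (\<lambda>y. y = x) w = replicate (count_list w x) x"
  by (induction w) auto

lemma count_list_filter: "count_list (filter P w) x = (if P x then count_list w x else 0)"
  by (induction w) auto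

lemma count_list_replicate: "count_list (replicate n x) y = (if x = y then n else 0)"
  by (induction n) auto

lemma rigid_replicate: "rigid (replicate n x) \<longleftrightarrow> n < 3"
proof (cases "n \<le> 3")
  case True
  then consider "n = 0" | "n = 1" | "n = 2" | "n = 3" by linarith
  then show ?thesis by cases (auto simp: rigid_def numeral_eq_Suc)
qed (auto simp: rigid_def)

lemma rigid_identities_count:
  assumes "(u, v) \<in> rigid_identities"
  shows "count_list u x = count_list v x \<or> count_list u x \<ge> 3 \<and> count_list v x \<ge> 3"
proof (rule ccontr)
  assume a: "\<not> ?thesis"
  then have "rigid (filter (\<lambda>y. y = x) u) \<or> rigid (filter (\<lambda>y. y = x) v)"
    by (auto simp: filter_eq_replicate rigid_replicate)
  from rigid_identitiesD[OF assms this] have "count_list u x = count_list v x"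
    by (simp add: filter_eq_replicate replicate_eq_replicate)
  with a show False by simp
qed

lemma length_filter_two:
  "\<lbrakk>P x; P y; x \<noteq> y\<rbrakk> \<Longrightarrow> count_list w x + count_list w y \<le> length (filter P w)"
  by (induction w) auto

text \<open>
  Two letters with two occurrences each already make a projection too long to be rigid. This is why
  neighbouring occurrences of nonsimple letters may be exchanged freely.
\<close>
lemma not_rigid_two:
  assumes "P x" "P y" "x \<noteq> y" "count_list w x \<ge> 2" "count_list w y \<ge> 2"
  shows "\<not> rigid (filter P w)"
  using length_filter_two[OF assms(1-3), of w] assms(4,5) by (auto simp: rigid_def)

text \<open>
  An occurrence of a nonsimple letter \<open>x\<close> moves across a block \<open>q\<close> of nonsimple letters: a projection
  that notices the move contains \<open>x\<close> and another nonsimple letter.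
\<close>
lemma rigid_identities_shift:
  assumes "count_list (p @ q @ x # r) x \<ge> 2"
    and "\<And>y. y \<in> set q \<Longrightarrow> count_list (p @ q @ x # r) y \<ge> 2"
  shows "(p @ q @ x # r, p @ x # q @ r) \<in> rigid_identities" (is "(?u, ?v) \<in> _")
proof -
  have cnt: "count_list ?v y = count_list ?u y" for y by simp
  show ?thesis
  proof (rule rigid_identitiesI)
    fix P
    show "filter P ?u = filter P ?v \<or> \<not> rigid (filter P ?u) \<and> \<not> rigid (filter P ?v)"
    proof (cases "P x \<and> (\<exists>y\<in>set q. P y \<and> y \<noteq> x)")
      case True
      then obtain y where y: "P x" "P y" "x \<noteq> y" "y \<in> set q" by blast
      show ?thesis
        using not_rigid_two[OF y(1-3), of ?u] not_rigid_two[OF y(1-3), of ?v] assms(1) assms(2)[OF y(4)]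
        unfolding cnt by blast
    next
      case False
      show ?thesis
      proof (cases "P x")
        case True
        then have "filter P q = filter (\<lambda>y. y = x) q" using False by (intro filter_cong) auto
        then show ?thesis using True by (simp add: filter_eq_replicate replicate_app_Cons_same)
      qed simp
    qed
  qed
qed

lemma removeAll_eq_filter: "removeAll x w = filter (\<lambda>y. y \<noteq> x) w"
  by (induction w) auto

lemma not_rigid_three:
  assumes P: "P x" and c: "count_list w x \<ge> 3"
  shows "\<not> rigid (filter P w)"
proof
  assume r: "rigid (filter P w)"
  have "length (filter P w) = 3"
  proof -
    have "count_list w x \<le> length (filter P w)" using P by (induction w) auto
    then show ?thesis using c r by (auto simp: rigid_def)
  qed
  moreover have "filter (\<lambda>y. y = x) (filter P w) = filter P w"
  proof -
    have "length (filter (\<lambda>y. y = x) (filter P w)) \<ge> length (filter P w)"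
      using c P \<open>length _ = 3\<close> by (simp add: filter_eq_replicate count_list_filter)
    then show ?thesis
      by (meson filter_id_conv length_filter_less linorder_not_less)
  qed
  ultimately have "filter P w = replicate 3 x"
    using filter_eq_replicate[of x "filter P w"] by (metis length_replicate)
  then show False using r by (simp add: rigid_replicate)
qed

lemma rigid_identities_cube:
  assumes "count_list u x \<ge> 3"
  shows "(u, [x, x, x] @ removeAll x u) \<in> rigid_identities"
proof -
  let ?v = "[x, x, x] @ removeAll x u"
  from not_rigid_three[of _ x u] not_rigid_three[of _ x ?v] assms
  have cube: "\<not> rigid (filter P u) \<and> \<not> rigid (filter P ?v)" if "P x" for P
    using that by (simp add: numeral_3_eq_3)
  show ?thesis
  proof (rule rigid_identitiesI)
    fix P
    show "filter P u = filter P ?v \<or> \<not> rigid (filter P u) \<and> \<not> rigid (filter P ?v)"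
    proof (cases "P x")
      case False
      then have "filter P u = filter P ?v"
        by (auto simp: removeAll_eq_filter intro!: filter_cong)
      then show ?thesis ..
    qed (use cube in blast)
  qed
qed

lemma rigid_identities_frequent:
  assumes "set u = set v" "\<And>x. x \<in> set u \<Longrightarrow> count_list u x \<ge> 3 \<and> count_list v x \<ge> 3"
  shows "(u, v) \<in> rigid_identities"
proof (rule rigid_identitiesI)
  fix P
  show "filter P u = filter P v \<or> \<not> rigid (filter P u) \<and> \<not> rigid (filter P v)"
  proof (cases "\<exists>x\<in>set u. P x")
    case True
    then show ?thesis using not_rigid_three assms(2) by metis
  next
    case False
    then have "filter P u = []" "filter P v = []" using assms(1) by (auto simp: filter_empty_conv)
    then show ?thesis by simp
  qed
qed

section \<open>Equational theories and seven laws\<close>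

text \<open>
  The last three laws compare the possible positions of two occurrences of the letter \<open>x = 0\<close> relative
  to one occurrence of \<open>t = 1\<close>: both to the left of \<open>t\<close>, both to its right, or with \<open>t\<close> in the middle.
\<close>
datatype law = Trivial | Idempotent | Commutative | Square_Cube | Mid_Left | Mid_Right | Left_Right

primrec law_identity :: "law \<Rightarrow> identity" where
  "law_identity Trivial = ([0], [])"
| "law_identity Idempotent = ([0], [0, 0])"
| "law_identity Commutative = ([0, 1], [1, 0])"
| "law_identity Square_Cube = ([0, 0], [0, 0, 0])"
| "law_identity Mid_Left = ([0, 1, 0], [0, 0, 1])"
| "law_identity Mid_Right = ([0, 1, 0], [1, 0, 0])"
| "law_identity Left_Right = ([0, 0, 1], [1, 0, 0])"

definition laws :: "identity set \<Rightarrow> law set" where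
  "laws T = {l. law_identity l \<in> T}"

text \<open>
  The value \<open>None\<close> stands for the beginning of the word. For \<open>Some t\<close> the insertion is the
  substitution of \<open>tx\<close> for \<open>t\<close>, so that every equational theory is closed under it.
\<close>
definition insert_after :: "nat \<Rightarrow> nat option \<Rightarrow> word \<Rightarrow> word" where
  "insert_after x a w = (case a of None \<Rightarrow> x # w
     | Some t \<Rightarrow> concat (map (\<lambda>y. if y = t then [t, x] else [y]) w))"

text \<open>
  The position at which a letter has to be inserted in order to end up in the same block, between two
  consecutive simple letters, as an occurrence with \<open>w\<close> in front of it.
\<close>
definition anchor :: "(nat \<Rightarrow> bool) \<Rightarrow> word \<Rightarrow> nat option" where
  "anchor S w = (if filter S w = [] then None else Some (last (filter S w)))"

locale equational_theory =
  fixes T :: "identity set"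
  assumes refl [simp, intro!]: "(u, u) \<in> T"
    and sym: "(u, v) \<in> T \<Longrightarrow> (v, u) \<in> T"
    and trans [trans]: "(u, v) \<in> T \<Longrightarrow> (v, w) \<in> T \<Longrightarrow> (u, w) \<in> T"
    and mult: "(u, u') \<in> T \<Longrightarrow> (v, v') \<in> T \<Longrightarrow> (u @ v, u' @ v') \<in> T"
    and subst: "(u, v) \<in> T \<Longrightarrow> (concat (map \<sigma> u), concat (map \<sigma> v)) \<in> T"
begin

abbreviation equivalent (infix \<open>\<approx>\<close> 50) where "u \<approx> v \<equiv> (u, v) \<in> T"

lemma context_closed: "u \<approx> v \<Longrightarrow> p @ u @ r \<approx> p @ v @ r"
  by (intro mult refl)

lemma delete: "u \<approx> v \<Longrightarrow> filter P u \<approx> filter P v"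
proof -
  assume "u \<approx> v"
  moreover have "concat (map (\<lambda>x. if P x then [x] else []) w) = filter P w" for w :: word
    by (induction w) auto
  ultimately show ?thesis using subst[of u v "\<lambda>x. if P x then [x] else []"] by metis
qed

lemma law_instance:
  assumes "l \<in> laws T"
  shows "concat (map (\<lambda>i. if i = 0 then u else v) (fst (law_identity l)))
    \<approx> concat (map (\<lambda>i. if i = 0 then u else v) (snd (law_identity l)))"
  using assms by (intro subst) (simp add: laws_def)

lemma law_instances:
  "Trivial \<in> laws T \<Longrightarrow> u \<approx> []"
  "Idempotent \<in> laws T \<Longrightarrow> u \<approx> u @ u"
  "Commutative \<in> laws T \<Longrightarrow> u @ v \<approx> v @ u"
  "Square_Cube \<in> laws T \<Longrightarrow> u @ u \<approx> u @ u @ u"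
  "Mid_Left \<in> laws T \<Longrightarrow> u @ v @ u \<approx> u @ u @ v"
  "Mid_Right \<in> laws T \<Longrightarrow> u @ v @ u \<approx> v @ u @ u"
  "Left_Right \<in> laws T \<Longrightarrow> u @ u @ v \<approx> v @ u @ u"
  using law_instance[of Trivial u v] law_instance[of Idempotent u v] law_instance[of Commutative u v]
    law_instance[of Square_Cube u v] law_instance[of Mid_Left u v] law_instance[of Mid_Right u v]
    law_instance[of Left_Right u v] by simp_all

lemma insert_after_closed: "u \<approx> v \<Longrightarrow> insert_after x a u \<approx> insert_after x a v"
  using mult[OF refl[of "[x]"]] by (auto simp: insert_after_def split: option.split intro: subst)

lemma commutative_bring_front:
  assumes "Commutative \<in> laws T"
  shows "w \<approx> replicate (count_list w x) x @ removeAll x w"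
proof (induction w)
  case (Cons y w)
  have "y # w = [y] @ w @ []" by simp
  also have "\<dots> \<approx> [y] @ (replicate (count_list w x) x @ removeAll x w) @ []"
    by (intro context_closed Cons.IH)
  finally have *: "y # w \<approx> [y] @ replicate (count_list w x) x @ removeAll x w" by simp
  show ?case
  proof (cases "y = x")
    case False
    have "[] @ ([y] @ replicate (count_list w x) x) @ removeAll x w
        \<approx> [] @ (replicate (count_list w x) x @ [y]) @ removeAll x w"
      by (intro context_closed law_instances assms)
    with * False show ?thesis by (auto intro: trans)
  qed (use * in simp)
qed simp

lemma permutation_closed:
  assumes "Commutative \<in> laws T" "\<And>x. count_list u x = count_list v x"
  shows "u \<approx> v"
  using assms(2)
proof (induction "length u" arbitrary: u v rule: less_induct)
  case less
  show ?case
  proof (cases u)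
    case Nil
    with less.prems have "set v = {}" by (metis count_list.simps(1) count_list_0_iff ex_in_conv)
    with Nil show ?thesis by simp
  next
    case (Cons x u')
    let ?n = "count_list u x"
    have "length (removeAll x u) < length u" using Cons by (intro length_removeAll_less) simp
    then have "removeAll x u \<approx> removeAll x v"
      using less.prems by (intro less.hyps) (simp_all add: removeAll_eq_filter count_list_filter)
    then have "replicate ?n x @ removeAll x u \<approx> replicate ?n x @ removeAll x v"
      by (intro mult refl)
    then show ?thesis
      using commutative_bring_front[OF assms(1), of u x] commutative_bring_front[OF assms(1), of v x]
        less.prems[of x] by (metis sym trans)
  qed
qed

end

text \<open>
  The induction used for every inclusion between theories below: remove nonsimple letters from both
  sides of an identity until each letter occurs at most once.
\<close>
lemma (in equational_theory) letter_removal_induct: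
  assumes uv: "(u, v) \<in> Q"
    and del: "\<And>u v x. (u, v) \<in> Q \<Longrightarrow> (removeAll x u, removeAll x v) \<in> Q"
    and linear: "\<And>u v. (u, v) \<in> Q \<Longrightarrow> (\<And>x. count_list u x \<le> 1) \<Longrightarrow> u \<approx> v"
    and step: "\<And>u v x. (u, v) \<in> Q \<Longrightarrow> count_list u x \<ge> 2 \<Longrightarrow>
      removeAll x u \<approx> removeAll x v \<Longrightarrow> u \<approx> v"
  shows "u \<approx> v"
  using uv
proof (induction "length u" arbitrary: u v rule: less_induct)
  case less
  show ?case
  proof (cases "\<forall>x. count_list u x \<le> 1")
    case False
    then obtain x where x: "count_list u x \<ge> 2" by (metis Suc_1 not_less_eq_eq)
    then have "x \<in> set u" by (metis count_list_0_iff not_numeral_le_zero)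
    then have "length (removeAll x u) < length u" by (rule length_removeAll_less)
    with less have "removeAll x u \<approx> removeAll x v" by (blast intro: del)
    with x less.prems show ?thesis by (blast intro: step)
  qed (use less.prems linear in blast)
qed

section \<open>Theories containing the rigid identities\<close>

text \<open>
  The implications between the laws that are valid in every theory containing the rigid identities.
\<close>
definition closed_laws :: "law set \<Rightarrow> bool" where
  "closed_laws L \<longleftrightarrow>
     (Trivial \<in> L \<longrightarrow> Idempotent \<in> L) \<and>
     (Idempotent \<in> L \<longrightarrow> Commutative \<in> L \<and> Square_Cube \<in> L) \<and>
     (Commutative \<in> L \<longrightarrow> Mid_Left \<in> L \<and> Mid_Right \<in> L) \<and>
     (Square_Cube \<in> L \<longrightarrow> Left_Right \<in> L) \<and>
     (Mid_Left \<in> L \<and> Mid_Right \<in> L \<longrightarrow> Left_Right \<in> L) \<and>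
     (Mid_Left \<in> L \<and> Left_Right \<in> L \<longrightarrow> Mid_Right \<in> L) \<and>
     (Mid_Right \<in> L \<and> Left_Right \<in> L \<longrightarrow> Mid_Left \<in> L)"

lemma distinct_eq_by_pairs:
  assumes "distinct u" "distinct v" "set u = set v"
    and "\<And>x y. x \<in> set u \<Longrightarrow> y \<in> set u \<Longrightarrow> x \<noteq> y \<Longrightarrow>
      filter (\<lambda>z. z = x \<or> z = y) u = filter (\<lambda>z. z = x \<or> z = y) v"
  shows "u = v"
  using assms
proof (induction u arbitrary: v)
  case (Cons x u)
  then obtain y v' where v: "v = y # v'" by (cases v) auto
  have "x = y"
  proof (rule ccontr)
    assume "x \<noteq> y"
    moreover have "y \<in> set (x # u)" using Cons.prems(3) v by simp
    ultimately show False using Cons.prems(4)[of x y] v by simp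
  qed
  moreover have "u = v'"
  proof (rule Cons.IH)
    show "distinct u" "distinct v'" using Cons.prems(1,2) v by simp_all
    show "set u = set v'" using Cons.prems(1-3) v \<open>x = y\<close> by (simp add: insert_ident)
    fix a b assume ab: "a \<in> set u" "b \<in> set u" "a \<noteq> b"
    then have "a \<noteq> x" "b \<noteq> x" using Cons.prems(1) by auto
    then show "filter (\<lambda>z. z = a \<or> z = b) u = filter (\<lambda>z. z = a \<or> z = b) v'"
      using Cons.prems(4)[of a b] ab v \<open>x = y\<close> by simp
  qed
  ultimately show ?case using v by simp
qed simp

lemma distinct_if_count_le_1:
  assumes "\<And>x. count_list w x \<le> 1"
  shows "distinct w"
  using assms
proof (induction w)
  case (Cons y w)
  have "count_list w x \<le> 1" for x using Cons.prems[of x] by (auto split: if_splits)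
  moreover have "count_list w y = 0" using Cons.prems[of y] by simp
  ultimately show ?case using Cons.IH by (simp add: count_list_0_iff)
qed simp

lemma distinct_filter_once: "distinct (filter (\<lambda>x. count_list w x = 1) w)"
  by (rule distinct_if_count_le_1) (simp add: count_list_filter)

locale rigid_theory = equational_theory +
  assumes rigid_identities: "rigid_identities \<subseteq> T"
begin

lemma rigid: "(u, v) \<in> rigid_identities \<Longrightarrow> u \<approx> v"
  using rigid_identities by blast

lemma power_substitute:
  "replicate m x \<approx> replicate n x \<Longrightarrow> concat (replicate m u) \<approx> concat (replicate n u)"
  using subst[of "replicate m x" "replicate n x" "\<lambda>_. u"] by simp

lemma power_rename: "replicate m x \<approx> replicate n x \<Longrightarrow> replicate m y \<approx> replicate n y"
  using power_substitute[of m x n "[y]"] by simp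

lemma high_powers: "m \<ge> 3 \<Longrightarrow> n \<ge> 3 \<Longrightarrow> replicate m x \<approx> replicate n x"
  by (rule rigid, rule rigid_identities_frequent) (auto simp: count_list_replicate)

text \<open>
  As all powers of a letter from the third on coincide, an identity between different powers amounts to
  one of three laws, according to its smaller exponent. If \<open>x\<^sup>n\<close> is the empty word, then so is \<open>x\<^sup>3\<^sup>n\<close>, and \<open>x = x\<^sup>3\<^sup>n\<^sup>+\<^sup>1 = x\<^sup>3\<^sup>n\<close>.
\<close>
lemma power_laws:
  assumes "replicate m x \<approx> replicate n x" "m < n"
  shows "m = 0 \<Longrightarrow> Trivial \<in> laws T" "m = 1 \<Longrightarrow> Idempotent \<in> laws T"
    "m = 2 \<Longrightarrow> Square_Cube \<in> laws T"
proof -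
  note eq = power_rename[OF assms(1), of 0]
  show "Trivial \<in> laws T" if m: "m = 0"
  proof -
    \<comment> \<open>The exponent is tripled to get into the range in which all powers coincide.\<close>
    have long: "[] \<approx> replicate (n * 3) 0"
    proof -
      have "concat (replicate k (replicate 3 0)) = (replicate (k * 3) 0 :: word)" for k
        by (induction k) (simp_all add: replicate_add)
      then show ?thesis using power_substitute[OF eq, of "replicate 3 0"] m by simp
    qed
    have "[0] @ [] \<approx> [0] @ replicate (n * 3) 0" by (intro mult long refl)
    also have "[0] @ replicate (n * 3) 0 = (replicate (n * 3 + 1) 0 :: word)" by simp
    also have "replicate (n * 3 + 1) 0 \<approx> replicate (n * 3) 0" using assms(2) by (intro high_powers) auto
    also have "replicate (n * 3) 0 \<approx> []" by (rule sym[OF long])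
    finally show ?thesis by (simp add: laws_def)
  qed
  show "Idempotent \<in> laws T" if m: "m = 1"
  proof (cases "n = 2")
    case True
    then show ?thesis using eq m by (simp add: laws_def numeral_2_eq_2)
  next
    case False
    have "[0] @ [0] \<approx> [0] @ replicate n 0" using eq m by (intro mult refl) simp
    also have "[0] @ replicate n 0 = (replicate (n + 1) 0 :: word)" by simp
    also have "replicate (n + 1) 0 \<approx> replicate n 0" using assms(2) False m by (intro high_powers) auto
    also have "replicate n 0 \<approx> [0]" using sym[OF eq] m by simp
    finally have "[0] @ [0] \<approx> [0]" .
    from sym[OF this] show ?thesis by (simp add: laws_def)
  qed
  show "Square_Cube \<in> laws T" if m: "m = 2"
  proof -
    have "replicate 2 0 \<approx> replicate n 0" using eq m by simp
    also have "replicate n 0 \<approx> replicate 3 0" using assms(2) m by (intro high_powers) auto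
    finally show ?thesis by (simp add: laws_def numeral_eq_Suc)
  qed
qed

lemma count_powers: "u \<approx> v \<Longrightarrow> replicate (count_list u x) x \<approx> replicate (count_list v x) x"
  using delete[of u v "\<lambda>y. y = x"] by (simp add: filter_eq_replicate)

lemma cube_commutes: "[x, x, x] @ w \<approx> w @ [x, x, x]"
proof -
  have "[0, 0, 0, 1] \<approx> [1, 0, 0, 0]"
    using rigid_identities_cube[of "[1, 0, 0, 0]" 0] by (simp add: rigid sym)
  from subst[OF this, of "\<lambda>i. if i = 0 then [x] else w"] show ?thesis by simp
qed

text \<open>
  Idempotency implies commutativity because cubes commute with every word modulo the rigid identities;
  for the same reason \<open>x\<^sup>2 = x\<^sup>3\<close> makes squares commute with everything.
\<close>
lemma closed_laws: "closed_laws (laws T)"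
proof -
  have "Idempotent \<in> laws T" if "Trivial \<in> laws T"
    using law_instances(1)[OF that, of "[0]"] law_instances(1)[OF that, of "[0, 0]"]
    by (simp add: laws_def) (metis sym trans)
  moreover have "Commutative \<in> laws T" if i: "Idempotent \<in> laws T"
  proof -
    have cube: "[x] \<approx> [x, x, x]" for x
    proof -
      have "[x] \<approx> [x] @ [x]" by (rule law_instances(2)[OF i])
      also have "[x] @ [x] \<approx> [x] @ [x, x]" using law_instances(2)[OF i, of "[x]"] by (intro mult refl) simp
      finally show ?thesis by simp
    qed
    have "[0] @ [1] \<approx> [0, 0, 0] @ [1, 1, 1]" by (intro mult cube)
    also have "[0, 0, 0] @ [1, 1, 1] \<approx> [1, 1, 1] @ [0, 0, 0]" by (rule cube_commutes)
    also have "[1, 1, 1] @ [0, 0, 0] \<approx> [1] @ [0]" by (intro mult sym[OF cube])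
    finally show ?thesis by (simp add: laws_def)
  qed
  moreover have "Square_Cube \<in> laws T" if "Idempotent \<in> laws T"
    using mult[OF refl[of "[0]"] law_instances(2)[OF that, of "[0]"]] by (simp add: laws_def)
  moreover have "Mid_Left \<in> laws T" "Mid_Right \<in> laws T" if "Commutative \<in> laws T"
    using permutation_closed[OF that, of "[0, 1, 0]" "[0, 0, 1]"]
      permutation_closed[OF that, of "[0, 1, 0]" "[1, 0, 0]"] by (simp_all add: laws_def)
  moreover have "Left_Right \<in> laws T" if s: "Square_Cube \<in> laws T"
  proof -
    have sq: "[0, 0] \<approx> [0, 0, 0]" using s by (simp add: laws_def)
    have "[0, 0] @ [1] \<approx> [0, 0, 0] @ [1]" by (intro mult sq refl)
    also have "[0, 0, 0] @ [1] \<approx> [1] @ [0, 0, 0]" by (rule cube_commutes)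
    also have "[1] @ [0, 0, 0] \<approx> [1] @ [0, 0]" by (intro mult sym[OF sq] refl)
    finally show ?thesis by (simp add: laws_def)
  qed
  moreover have "Left_Right \<in> laws T" if "Mid_Left \<in> laws T" "Mid_Right \<in> laws T"
    using that by (simp add: laws_def) (metis sym trans)
  moreover have "Mid_Right \<in> laws T" if "Mid_Left \<in> laws T" "Left_Right \<in> laws T"
    using that by (simp add: laws_def) (metis sym trans)
  moreover have "Mid_Left \<in> laws T" if "Mid_Right \<in> laws T" "Left_Right \<in> laws T"
    using that by (simp add: laws_def) (metis sym trans)
  ultimately show ?thesis unfolding closed_laws_def by blast
qed

text \<open>
  The next four lemmas read the description of a word from a theory: the missing laws guarantee that
  content, simple letters and the order of the simple letters are preserved.
\<close>
lemma count_0_iff: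
  assumes "u \<approx> v" "Trivial \<notin> laws T"
  shows "count_list u x = 0 \<longleftrightarrow> count_list v x = 0"
  using power_laws(1)[OF count_powers[OF assms(1), of x]]
    power_laws(1)[OF count_powers[OF sym[OF assms(1)], of x]] assms(2) by auto

lemma set_eq:
  assumes "u \<approx> v" "Trivial \<notin> laws T"
  shows "set u = set v"
  using count_0_iff[OF assms] by (auto simp: count_list_0_iff)

lemma count_1_iff:
  assumes "u \<approx> v" "Idempotent \<notin> laws T"
  shows "count_list u x = 1 \<longleftrightarrow> count_list v x = 1"
proof -
  have "Trivial \<notin> laws T" using assms(2) closed_laws by (auto simp: closed_laws_def)
  note zero = count_0_iff[OF assms(1) this, of x]
  show ?thesis
    using power_laws(2)[OF count_powers[OF assms(1), of x]]
      power_laws(2)[OF count_powers[OF sym[OF assms(1)], of x]] assms(2) zero by linarith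
qed

lemma simple_letters_eq:
  assumes uv: "u \<approx> v" and nc: "Commutative \<notin> laws T"
  shows "filter (\<lambda>x. count_list u x = 1) u = filter (\<lambda>x. count_list v x = 1) v"
proof -
  have ni: "Idempotent \<notin> laws T" using nc closed_laws by (auto simp: closed_laws_def)
  then have nt: "Trivial \<notin> laws T" using closed_laws by (auto simp: closed_laws_def)
  let ?S = "\<lambda>x. count_list u x = 1"
  have S: "(\<lambda>x. count_list v x = 1) = ?S" using count_1_iff[OF uv ni] by auto
  have sets: "set (filter ?S u) = set (filter ?S v)" using set_eq[OF uv nt] by auto
  have "filter ?S u = filter ?S v"
  proof (rule distinct_eq_by_pairs[OF distinct_filter_once _ sets])
    show "distinct (filter ?S v)" using distinct_filter_once[of v] unfolding S .
    fix x y assume "x \<in> set (filter ?S u)" "y \<in> set (filter ?S u)" and xy: "x \<noteq> y"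
    then have x: "count_list u x = 1" and y: "count_list u y = 1" by auto
    let ?F = "filter (\<lambda>z. z = x \<or> z = y)"
    have pair: "?F w = [x, y] \<or> ?F w = [y, x]" if "count_list w x = 1" "count_list w y = 1" for w
    proof -
      have len: "length (?F w) = count_list w x + count_list w y" for w using xy by (induction w) auto
      then have "length (?F w) = 2" using that by simp
      then obtain a b where ab: "?F w = [a, b]" by (auto simp: numeral_2_eq_2 length_Suc_conv)
      have "a \<in> set (?F w)" "b \<in> set (?F w)" by (simp_all only: ab list.set insert_iff simp_thms)
      then have "a \<in> {x, y}" "b \<in> {x, y}" by auto
      moreover have "count_list (?F w) x = 1" "count_list (?F w) y = 1"
        using that by (simp_all add: count_list_filter)
      ultimately show ?thesis using xy unfolding ab by auto
    qed
    have v: "count_list v x = 1" "count_list v y = 1" using count_1_iff[OF uv ni] x y by simp_all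
    have F: "?F u \<approx> ?F v" by (rule delete[OF uv])
    \<comment> \<open>Two simple letters in the opposite order would give commutativity.\<close>
    have swap: "\<not> [a, b] \<approx> [b, a]" if "a \<noteq> b" for a b
    proof
      assume "[a, b] \<approx> [b, a]"
      from subst[OF this, of "\<lambda>z. if z = a then [0] else [1]"] that nc
      show False by (simp add: laws_def)
    qed
    have "?F u = ?F v"
      using pair[OF x y] pair[OF v] F swap[OF xy] swap[OF xy[symmetric]] by (elim disjE) simp_all
    then show "?F (filter ?S u) = ?F (filter ?S v)"
    proof -
      have "?F (filter ?S w) = ?F w" for w unfolding filter_filter using x y by (intro filter_cong) auto
      then show "?F u = ?F v \<Longrightarrow> ?thesis" by simp
    qed
  qed
  then show ?thesis unfolding S .
qed

end

section \<open>Reinserting a deleted letter\<close>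

lemma insert_after_None [simp]: "insert_after x None w = x # w"
  by (simp add: insert_after_def)

lemma insert_after_absent: "t \<notin> set w \<Longrightarrow> concat (map (\<lambda>y. if y = t then [t, x] else [y]) w) = w"
  by (induction w) auto

lemma insert_after_Some:
  "\<lbrakk>t \<notin> set p; t \<notin> set r\<rbrakk> \<Longrightarrow> insert_after x (Some t) (p @ t # r) = p @ t # x # r"
  by (simp add: insert_after_def insert_after_absent)

lemma insert_after_append:
  "(\<And>t. a = Some t \<Longrightarrow> t \<notin> set r) \<Longrightarrow> insert_after x a (p @ r) = insert_after x a p @ r"
  by (cases a) (simp_all add: insert_after_def insert_after_absent)

lemma count_list_insert_after:
  assumes "\<And>t. a = Some t \<Longrightarrow> count_list w t = 1"
  shows "count_list (insert_after x a w) y = count_list (x # w) y"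
proof (cases a)
  case (Some t)
  have "count_list (concat (map (\<lambda>y. if y = t then [t, x] else [y]) w)) y =
      count_list w y + (if x = y then count_list w t else 0)"
    by (induction w) auto
  then show ?thesis using assms[OF Some] Some by (simp add: insert_after_def)
qed simp

lemma filter_insert_after: "\<not> S x \<Longrightarrow> filter S (insert_after x a w) = filter S w"
proof (cases a)
  case (Some t)
  assume "\<not> S x"
  then have "filter S (concat (map (\<lambda>y. if y = t then [t, x] else [y]) w)) = filter S w"
    by (induction w) auto
  then show ?thesis using Some by (simp add: insert_after_def)
qed simp

lemma anchor_cong: "filter S v = filter S w \<Longrightarrow> anchor S v = anchor S w"
  by (simp add: anchor_def)

lemma anchor_SomeD: "anchor S w = Some t \<Longrightarrow> t \<in> set w \<and> S t"
  using last_in_set[of "filter S w"] by (auto simp: anchor_def split: if_splits)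

lemma split_two_occurrences:
  assumes "count_list u x = 2"
  obtains p q r where "u = p @ x # q @ x # r" "x \<notin> set p" "x \<notin> set q" "x \<notin> set r"
proof -
  have "x \<in> set u" using assms by (metis count_list_0_iff zero_neq_numeral)
  then obtain p s where u: "u = p @ x # s" and p: "x \<notin> set p" by (metis split_list_first)
  then have s: "count_list s x = 1" using assms by (simp add: count_list_0_iff)
  then have "x \<in> set s" by (metis count_list_0_iff zero_neq_one)
  then obtain q r where "s = q @ x # r" "x \<notin> set q" by (metis split_list_first)
  with s u p show thesis by (intro that[of p q r]) (auto simp: count_list_0_iff)
qed

text \<open>
  Blocks of simple letters before, between and after the two occurrences of a letter: if the letters
  in the middle are known, and there are some, then the order of the simple letters determines the rest.
\<close>
lemma distinct_middle_eq:
  assumes eq: "A @ B @ C = A' @ B' @ C'" and d: "distinct (A @ B @ C)"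
    and sets: "set B = set B'" and ne: "B \<noteq> []"
  shows "A = A' \<and> B = B'"
proof -
  have *: "us = []" if "B @ C = us @ B' @ C'" "distinct (B @ C)" "set B = set B'" "B \<noteq> []"
    for us B C B' C' :: "'a list"
  proof (rule ccontr)
    assume "us \<noteq> []"
    then have "hd us = hd B" using that by (metis hd_append2)
    then have "hd us \<in> set B'" using that by (metis hd_in_set)
    moreover have "distinct (us @ B' @ C')" using that by simp
    ultimately show False using \<open>us \<noteq> []\<close> by (auto dest: hd_in_set)
  qed
  have ne': "B' \<noteq> []" using sets ne by auto
  have d': "distinct (A' @ B' @ C')" using d eq by simp
  have A: "A = A'"
    using append_eq_append_conv2[THEN iffD1, OF eq]
  proof (elim exE disjE conjE)
    fix us assume us: "A = A' @ us" "us @ B @ C = B' @ C'"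
    have "us = []" by (rule *[OF us(2)[symmetric] _ sets[symmetric] ne']) (use d' in simp)
    with us(1) show ?thesis by simp
  next
    fix us assume us: "A @ us = A'" "B @ C = us @ B' @ C'"
    have "us = []" by (rule *[OF us(2) _ sets ne]) (use d in simp)
    with us(1) show ?thesis by simp
  qed
  have "length B = length B'"
    using d d' sets by (metis distinct_append distinct_card)
  with A eq show ?thesis by simp
qed

lemma distinct_prefix_eq:
  assumes "A @ B = A' @ B'" "distinct (A @ B)" "set A = set A'"
  shows "A = A'"
proof -
  have "distinct (A' @ B')" using assms by simp
  then have "length A = length A'" using assms(2,3) by (metis distinct_append distinct_card)
  with assms(1) show ?thesis by simp
qed

context rigid_theory
begin

text \<open>
  Modulo the rigid identities an occurrence of a nonsimple letter moves left to the last simple letter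
  before it.
\<close>
lemma occurrence_to_anchor:
  assumes "count_list (p @ x # r) x \<ge> 2"
  shows "p @ x # r \<approx> insert_after x (anchor (\<lambda>t. count_list (p @ x # r) t = 1) p) (p @ r)"
proof -
  let ?w = "p @ x # r"
  let ?S = "\<lambda>t. count_list ?w t = 1"
  have multiple: "count_list ?w y \<ge> 2" if "y \<in> set p" "\<not> ?S y" for y
  proof -
    have "count_list ?w y \<noteq> 0" using that(1) unfolding count_list_0_iff by simp
    then show ?thesis using that(2) by linarith
  qed
  show ?thesis
  proof (cases "filter ?S p = []")
    case True
    then have "([] @ p @ x # r, [] @ x # p @ r) \<in> rigid_identities"
      using multiple assms by (intro rigid_identities_shift) (auto simp: filter_empty_conv)
    then show ?thesis using True by (simp add: anchor_def rigid)
  next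
    case False
    then have "\<exists>t\<in>set p. ?S t" by (auto simp: filter_empty_conv)
    from split_list_last_prop[OF this] obtain p1 t p2
      where p: "p = p1 @ t # p2" and t: "?S t" and p2: "\<forall>z\<in>set p2. \<not> ?S z" by blast
    have "filter ?S p2 = []" using p2 by (simp add: filter_empty_conv)
    then have "anchor ?S p = Some t" using t unfolding p anchor_def by simp
    moreover have "t \<notin> set p1" "t \<notin> set (p2 @ r)"
      using t unfolding p by (auto simp: count_list_0_iff split: if_splits)
    moreover have "((p1 @ [t]) @ p2 @ x # r, (p1 @ [t]) @ x # p2 @ r) \<in> rigid_identities"
      using multiple p2 assms unfolding p by (intro rigid_identities_shift) simp_all
    ultimately show ?thesis using insert_after_Some[of t p1 "p2 @ r" x] unfolding p by (simp add: rigid)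
  qed
qed

text \<open>
  A word is recovered from the word without the letter \<open>x\<close> by two insertions, which depend only on
  the anchors of the two occurrences.
\<close>
lemma two_occurrences_to_anchors:
  assumes S: "\<And>t. S t \<longleftrightarrow> count_list (p @ x # q @ x # r) t = 1"
  shows "p @ x # q @ x # r \<approx>
    insert_after x (anchor S (p @ q)) (insert_after x (anchor S p) (p @ q @ r))"
proof -
  let ?u = "p @ x # q @ x # r" and ?a = "anchor S p"
  have Sdef: "S = (\<lambda>t. count_list ?u t = 1)" using S by blast
  have nx: "\<not> S x" by (simp add: S)
  have once: "t \<notin> set r \<and> t \<noteq> x \<and> count_list (p @ q @ x # r) t = 1" if a: "?a = Some t" for t
  proof -
    have t: "t \<in> set p" "S t" using anchor_SomeD[OF a] by auto
    then have "t \<noteq> x" using nx by auto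
    moreover have "count_list p t \<ge> 1"
      using t(1) by (metis count_list_0_iff less_one linorder_not_less)
    moreover have "count_list p t + count_list q t + count_list r t = 1"
      using t(2) \<open>t \<noteq> x\<close> by (simp add: S)
    ultimately show ?thesis by (auto simp: count_list_0_iff[symmetric])
  qed
  let ?P = "insert_after x ?a (p @ q)"
  have "?u \<approx> insert_after x ?a (p @ (q @ x # r))"
    using occurrence_to_anchor[of p x "q @ x # r"] unfolding Sdef by simp
  also have "insert_after x ?a (p @ (q @ x # r)) = ?P @ x # r"
    using once insert_after_append[of ?a "x # r" x "p @ q"] by auto
  finally have 1: "?u \<approx> ?P @ x # r" .
  have cnt: "count_list (?P @ x # r) y = count_list ?u y" for y
    using count_list_insert_after[of ?a "p @ q @ x # r" x y] once
      insert_after_append[of ?a "x # r" x "p @ q"] by simp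
  have "?P @ x # r \<approx> insert_after x (anchor S ?P) (?P @ r)"
  proof -
    have "2 \<le> count_list (?P @ x # r) x" unfolding cnt by simp
    from occurrence_to_anchor[OF this] show ?thesis unfolding cnt Sdef[symmetric] .
  qed
  moreover have "anchor S ?P = anchor S (p @ q)"
    by (rule anchor_cong) (rule filter_insert_after[of S, OF nx])
  moreover have "?P @ r = insert_after x ?a (p @ q @ r)"
    using once insert_after_append[of ?a r x "p @ q"] by simp
  ultimately show ?thesis using 1 by (metis trans)
qed

lemma square_to_anchor:
  assumes "\<And>t. S t \<longleftrightarrow> count_list (p @ [x, x] @ r) t = 1"
  shows "p @ [x, x] @ r \<approx> insert_after x (anchor S p) (insert_after x (anchor S p) (p @ r))"
  using two_occurrences_to_anchors[of S p x "[]" r] assms by simp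

lemma same_block_gather:
  assumes "\<And>t. t \<in> set q \<Longrightarrow> count_list (p @ x # q @ x # r) t \<noteq> 1"
  shows "p @ x # q @ x # r \<approx> p @ [x, x] @ q @ r"
proof -
  have "count_list (p @ x # q @ x # r) t \<ge> 2" if "t \<in> set q" for t
  proof -
    have "count_list (p @ x # q @ x # r) t \<noteq> 0" using that unfolding count_list_0_iff by simp
    then show ?thesis using assms[OF that] by linarith
  qed
  then have "((p @ [x]) @ q @ x # r, (p @ [x]) @ x # q @ r) \<in> rigid_identities"
    by (intro rigid_identities_shift) simp_all
  then show ?thesis by (simp add: rigid)
qed

lemma square_to_front:
  assumes "Left_Right \<in> laws T"
  shows "p @ [x, x] @ r \<approx> [x, x] @ p @ r"
  using context_closed[OF sym[OF law_instances(7)[OF assms, of "[x]" p]], of "[]" r] by simp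

lemma gather_left:
  assumes "Mid_Left \<in> laws T"
  shows "p @ x # q @ x # r \<approx> p @ [x, x] @ q @ r"
  using context_closed[OF law_instances(5)[OF assms, of "[x]" q], of p r] by simp

lemma gather_right:
  assumes "Mid_Right \<in> laws T"
  shows "p @ x # q @ x # r \<approx> (p @ q) @ [x, x] @ r"
  using context_closed[OF law_instances(6)[OF assms, of "[x]" q], of p r] by simp

lemma cube_to_front: "count_list u x \<ge> 3 \<Longrightarrow> u \<approx> [x, x, x] @ removeAll x u"
  by (intro rigid rigid_identities_cube)

end

text \<open>
  Projecting an identity to \<open>x\<close> and a simple letter \<open>t\<close> either shows that \<open>t\<close> has the same position
  relative to \<open>x\<close> on both sides, or yields one of the three laws on such positions.
\<close>
lemma (in equational_theory) relative_position_laws: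
  assumes uv: "p @ x # q @ x # r \<approx> p' @ x # q' @ x # r'"
    and x: "x \<notin> set p \<union> set q \<union> set r \<union> set p' \<union> set q' \<union> set r'"
    and t: "t \<noteq> x" "count_list (p @ x # q @ x # r) t = 1" "count_list (p' @ x # q' @ x # r') t = 1"
  shows "t \<in> set p \<and> t \<in> set p' \<or> t \<in> set q \<and> t \<in> set q' \<or> t \<in> set r \<and> t \<in> set r' \<or>
    Mid_Left \<in> laws T \<and> (t \<in> set q \<and> t \<in> set r' \<or> t \<in> set r \<and> t \<in> set q') \<or>
    Mid_Right \<in> laws T \<and> (t \<in> set q \<and> t \<in> set p' \<or> t \<in> set p \<and> t \<in> set q') \<or>
    Left_Right \<in> laws T \<and> (t \<in> set r \<and> t \<in> set p' \<or> t \<in> set p \<and> t \<in> set r')"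
proof -
  let ?w = "\<lambda>i j k. replicate i 1 @ 0 # replicate j 1 @ 0 # replicate k (1 :: nat)"
  let ?\<sigma> = "\<lambda>z. if z = x then [0] else if z = t then [1 :: nat] else []"
  have block: "concat (map ?\<sigma> w) = replicate (count_list w t) 1" if "x \<notin> set w" for w
    using that t(1) by (induction w) auto
  \<comment> \<open>The substitution erases all letters except \<open>x\<close> and \<open>t\<close>, which become those of the laws.\<close>
  have proj: "?w (count_list p t) (count_list q t) (count_list r t)
      \<approx> ?w (count_list p' t) (count_list q' t) (count_list r' t)"
    using subst[OF uv, of ?\<sigma>] x by (simp add: block)
  have mem: "t \<in> set w" if "count_list w t = 1" for w using that by (metis count_list_0_iff zero_neq_one)
  have split: "i = 1 \<and> j = 0 \<and> k = 0 \<or> i = 0 \<and> j = 1 \<and> k = 0 \<or> i = 0 \<and> j = 0 \<and> k = 1"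
    if "i + j + k = 1" for i j k :: nat using that by arith
  have u: "count_list p t + count_list q t + count_list r t = 1"
    and v: "count_list p' t + count_list q' t + count_list r' t = 1" using t by simp_all
  show ?thesis
    using split[OF u] split[OF v] proj sym[OF proj] mem
    by (elim disjE conjE) (simp_all add: laws_def)
qed

section \<open>A theory is determined by its laws\<close>

text \<open>
  What \<open>T2\<close> does not forget
  about a word is preserved by \<open>T1\<close> as well, because a law absent from \<open>T2\<close> is absent from \<open>T1\<close>.
\<close>
locale theory_pair =
  A: rigid_theory T1 + B: rigid_theory T2 for T1 T2 :: "identity set" +
  assumes laws_le: "laws T1 \<subseteq> laws T2"
begin

text \<open>
  The five closed subsets of the last three laws are treated in turn. If both laws with \<open>t\<close> in the
  middle are in \<open>T2\<close>, the square of \<open>x\<close> moves to the front. If only one of them is, the two occurrences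
  meet at the left or at the right one, whose anchor \<open>T1\<close> preserves. If none is, then \<open>T1\<close> preserves
  the simple letters between the two occurrences; when there are any, both anchors are determined, and
  otherwise \<open>x\<close> behaves as a square, which the remaining law may still bring to the front.
\<close>
lemma reinsert_double_letter:
  assumes nc: "Commutative \<notin> laws T2" and uv: "(u, v) \<in> T1"
    and two: "count_list u x = 2" "count_list v x = 2"
    and rest: "(removeAll x u, removeAll x v) \<in> T2"
  shows "(u, v) \<in> T2"
proof -
  have closed: "closed_laws (laws T2)" by (rule B.closed_laws)
  have nc1: "Commutative \<notin> laws T1" using nc laws_le by blast
  then have ni1: "Idempotent \<notin> laws T1" using A.closed_laws unfolding closed_laws_def by blast
  obtain p q r where u: "u = p @ x # q @ x # r" and xu: "x \<notin> set p" "x \<notin> set q" "x \<notin> set r"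
    using split_two_occurrences[OF two(1)] .
  obtain p' q' r' where v: "v = p' @ x # q' @ x # r'"
    and xv: "x \<notin> set p'" "x \<notin> set q'" "x \<notin> set r'"
    using split_two_occurrences[OF two(2)] .
  have rest': "(p @ q @ r, p' @ q' @ r') \<in> T2" using rest xu xv by (simp add: u v)
  define S where "S t \<longleftrightarrow> count_list u t = 1" for t
  have Su: "S t \<longleftrightarrow> count_list u t = 1" and Sv: "S t \<longleftrightarrow> count_list v t = 1" for t
    using A.count_1_iff[OF uv ni1] by (simp_all add: S_def)
  have nx: "\<not> S x" using two by (simp add: S_def)
  define a b c where "a = filter S p" and "b = filter S q" and "c = filter S r"
  define a' b' c' where "a' = filter S p'" and "b' = filter S q'" and "c' = filter S r'"
  note defs = a_def b_def c_def a'_def b'_def c'_def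
  have S': "(\<lambda>t. count_list u t = 1) = S" "(\<lambda>t. count_list v t = 1) = S" using Su Sv by auto
  have order: "a @ b @ c = a' @ b' @ c'"
    using A.simple_letters_eq[OF uv nc1] nx unfolding S' by (simp add: u v defs)
  have dist: "distinct (a @ b @ c)"
    using distinct_filter_once[of u] nx unfolding S' by (simp add: u defs)
  have pos: "t \<in> set a \<and> t \<in> set a' \<or> t \<in> set b \<and> t \<in> set b' \<or> t \<in> set c \<and> t \<in> set c' \<or>
      Mid_Left \<in> laws T1 \<and> (t \<in> set b \<and> t \<in> set c' \<or> t \<in> set c \<and> t \<in> set b') \<or>
      Mid_Right \<in> laws T1 \<and> (t \<in> set b \<and> t \<in> set a' \<or> t \<in> set a \<and> t \<in> set b') \<or>
      Left_Right \<in> laws T1 \<and> (t \<in> set c \<and> t \<in> set a' \<or> t \<in> set a \<and> t \<in> set c')" if "S t" for t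
  proof -
    have "t \<noteq> x" using that nx by auto
    have "x \<notin> set p \<union> set q \<union> set r \<union> set p' \<union> set q' \<union> set r'" using xu xv by blast
    from A.relative_position_laws[OF uv[unfolded u v] this \<open>t \<noteq> x\<close>
        that[unfolded Su u] that[unfolded Sv v]] that
    show ?thesis by (simp add: defs)
  qed
  have inS: "S t" if "t \<in> set a \<union> set b \<union> set c \<union> set a' \<union> set b' \<union> set c'" for t
    using that by (auto simp: defs)
  have disj: "set a \<inter> set b = {}" "set a \<inter> set c = {}" "set b \<inter> set c = {}"
    using dist by auto
  have "distinct (a' @ b' @ c')" using dist order by simp
  then have disj': "set a' \<inter> set b' = {}" "set a' \<inter> set c' = {}" "set b' \<inter> set c' = {}"
    by auto
  have a_eq: "a = a'" if "Mid_Right \<notin> laws T1" "Left_Right \<notin> laws T1"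
  proof (rule distinct_prefix_eq[OF order dist])
    show "set a = set a'" using that pos inS disj disj' by blast
  qed
  have ab_eq: "a @ b = a' @ b'" if "Mid_Left \<notin> laws T1" "Left_Right \<notin> laws T1"
  proof (rule distinct_prefix_eq[of _ c _ c'])
    show "set (a @ b) = set (a' @ b')" using that pos inS disj disj' unfolding set_append by blast
  qed (use order dist in simp_all)
  have b_eq: "set b = set b'" if "Mid_Left \<notin> laws T1" "Mid_Right \<notin> laws T1"
    using that pos inS disj disj' by blast
  have anchor_p: "anchor S p = anchor S p'" if "a = a'"
    using that by (intro anchor_cong) (simp add: defs)
  have anchor_pq: "anchor S (p @ q) = anchor S (p' @ q')" if "a @ b = a' @ b'"
    using that by (intro anchor_cong) (simp add: defs)
  have ins: "(insert_after x e (insert_after x d (p @ q @ r)),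
      insert_after x e (insert_after x d (p' @ q' @ r'))) \<in> T2" for d e
    by (intro B.insert_after_closed rest')
  have front: "([x, x] @ p @ q @ r, [x, x] @ p' @ q' @ r') \<in> T2"
    by (intro B.mult rest' B.refl)
  have left_u: "(p @ [x, x] @ q @ r, insert_after x (anchor S p) (insert_after x (anchor S p) (p @ q @ r))) \<in> T2"
    by (rule B.square_to_anchor) (auto simp: Su u)
  have left_v: "(p' @ [x, x] @ q' @ r', insert_after x (anchor S p') (insert_after x (anchor S p') (p' @ q' @ r'))) \<in> T2"
    by (rule B.square_to_anchor) (auto simp: Sv v)
  have by_left: "(u, v) \<in> T2"
    if "(u, p @ [x, x] @ q @ r) \<in> T2" "(v, p' @ [x, x] @ q' @ r') \<in> T2" "a = a'"
    using B.trans[OF B.trans[OF that(1) left_u]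
        B.trans[OF ins[of "anchor S p" "anchor S p"] B.sym[OF B.trans[OF that(2) left_v,
          folded anchor_p[OF that(3)]]]]] .
  have by_front: "(u, v) \<in> T2"
    if "(u, p @ [x, x] @ q @ r) \<in> T2" "(v, p' @ [x, x] @ q' @ r') \<in> T2" "Left_Right \<in> laws T2"
    using B.trans[OF B.trans[OF that(1) B.square_to_front[OF that(3)]]
        B.trans[OF front B.sym[OF B.trans[OF that(2) B.square_to_front[OF that(3)]]]]] .
  show ?thesis
  proof (cases "Mid_Left \<in> laws T2")
    case ml: True
    have gu: "(u, p @ [x, x] @ q @ r) \<in> T2" and gv: "(v, p' @ [x, x] @ q' @ r') \<in> T2"
      unfolding u v by (rule B.gather_left[OF ml])+
    show ?thesis
    proof (cases "Left_Right \<in> laws T2")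
      case False
      then have "Mid_Right \<notin> laws T2" using ml closed unfolding closed_laws_def by blast
      with False show ?thesis using laws_le by (intro by_left gu gv a_eq) blast+
    qed (rule by_front[OF gu gv])
  next
    case nml: False
    show ?thesis
    proof (cases "Mid_Right \<in> laws T2")
      case mr: True
      then have "Left_Right \<notin> laws T2" using nml closed unfolding closed_laws_def by blast
      then have ab: "a @ b = a' @ b'" using nml laws_le by (intro ab_eq) blast+
      have gu: "(u, (p @ q) @ [x, x] @ r) \<in> T2" and gv: "(v, (p' @ q') @ [x, x] @ r') \<in> T2"
        unfolding u v by (rule B.gather_right[OF mr])+
      let ?e = "anchor S (p @ q)"
      have "((p @ q) @ [x, x] @ r, insert_after x ?e (insert_after x ?e ((p @ q) @ r))) \<in> T2"
        by (rule B.square_to_anchor) (auto simp: Su u)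
      moreover have "((p' @ q') @ [x, x] @ r', insert_after x ?e (insert_after x ?e ((p' @ q') @ r'))) \<in> T2"
        unfolding anchor_pq[OF ab] by (rule B.square_to_anchor) (auto simp: Sv v)
      moreover have "(insert_after x ?e (insert_after x ?e ((p @ q) @ r)),
          insert_after x ?e (insert_after x ?e ((p' @ q') @ r'))) \<in> T2"
        using ins[of ?e ?e] by simp
      ultimately show ?thesis using gu gv by (meson B.sym B.trans)
    next
      case nmr: False
      have bs: "set b = set b'" using nml nmr laws_le by (intro b_eq) blast+
      show ?thesis
      proof (cases "b = []")
        case False
        have ab: "a = a' \<and> b = b'" by (rule distinct_middle_eq[OF order dist bs False])
        have "(u, insert_after x (anchor S (p @ q)) (insert_after x (anchor S p) (p @ q @ r))) \<in> T2"
          unfolding u by (rule B.two_occurrences_to_anchors) (simp add: Su u)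
        moreover have "(v, insert_after x (anchor S (p' @ q')) (insert_after x (anchor S p') (p' @ q' @ r'))) \<in> T2"
          unfolding v by (rule B.two_occurrences_to_anchors) (simp add: Sv v)
        ultimately show ?thesis
          using ins anchor_p anchor_pq ab by (metis B.sym B.trans)
      next
        case True
        with bs have "b' = []" by simp
        have gu: "(u, p @ [x, x] @ q @ r) \<in> T2"
          unfolding u using True by (intro B.same_block_gather) (auto simp: defs Su u filter_empty_conv)
        have gv: "(v, p' @ [x, x] @ q' @ r') \<in> T2"
          unfolding v using \<open>b' = []\<close> by (intro B.same_block_gather) (auto simp: defs Sv v filter_empty_conv)
        show ?thesis
        proof (cases "Left_Right \<in> laws T2")
          case False
          with nmr show ?thesis using laws_le by (intro by_left gu gv a_eq) blast+
        qed (rule by_front[OF gu gv])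
      qed
    qed
  qed
qed

text \<open>
  If \<open>T1\<close> identifies a word with two occurrences of \<open>x\<close> and a word with more of them, then it contains
  \<open>x\<^sup>2 = x\<^sup>3\<close>, so \<open>x\<close> is as free in \<open>T2\<close> as a letter with three occurrences. A simple letter \<open>t\<close> between the
  two occurrences is no obstacle: \<open>T1\<close> then contains \<open>xtx = x\<^sup>3t = x\<^sup>2t\<close>.
\<close>
lemma double_letter_to_front:
  assumes nc: "Commutative \<notin> laws T2" and uv: "(u, v) \<in> T1"
    and cnt: "count_list u x = 2" "count_list v x \<ge> 3"
  shows "(u, [x, x, x] @ removeAll x u) \<in> T2"
proof -
  have "Idempotent \<notin> laws T2" using nc B.closed_laws unfolding closed_laws_def by blast
  then have ni1: "Idempotent \<notin> laws T1" using laws_le by blast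
  have sc1: "Square_Cube \<in> laws T1"
    using A.power_laws(3)[OF A.count_powers[OF uv, of x]] cnt by simp
  then have sc: "Square_Cube \<in> laws T2" using laws_le by blast
  then have lr: "Left_Right \<in> laws T2" using B.closed_laws unfolding closed_laws_def by blast
  obtain p q r where u: "u = p @ x # q @ x # r" and xu: "x \<notin> set p" "x \<notin> set q" "x \<notin> set r"
    using split_two_occurrences[OF cnt(1)] .
  have "(u, p @ [x, x] @ q @ r) \<in> T2"
  proof (cases "Mid_Left \<in> laws T2")
    case False
    have "count_list u t \<noteq> 1" if t: "t \<in> set q" for t
    proof
      assume one: "count_list u t = 1"
      then have onev: "count_list v t = 1" using A.count_1_iff[OF uv ni1] by simp
      have tx: "t \<noteq> x" using one cnt by auto
      let ?F = "filter (\<lambda>z. z = x \<or> z = t)"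
      have block: "?F w = replicate (count_list w t) t" if "x \<notin> set w" for w
        using that tx by (induction w) auto
      have "count_list q t \<noteq> 0" using t unfolding count_list_0_iff by simp
      then have "count_list p t = 0" "count_list q t = 1" "count_list r t = 0"
        using one tx unfolding u by auto
      then have Fu: "?F u = [x, t, x]" using xu tx by (simp add: u block)
      have "removeAll x (?F v) = [t]"
      proof -
        have "removeAll x (?F v) = filter (\<lambda>z. z = t) v"
          using tx unfolding removeAll_eq_filter filter_filter by (intro filter_cong) auto
        then show ?thesis using onev by (simp add: filter_eq_replicate)
      qed
      moreover have "count_list (?F v) x \<ge> 3" using cnt by (simp add: count_list_filter)
      ultimately have "(?F v, [x, x, x] @ [t]) \<in> T1" using A.cube_to_front[of "?F v" x] by simp
      moreover have "([x, x, x] @ [t], [x, x] @ [t]) \<in> T1"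
        using A.mult[OF A.sym[OF A.law_instances(4)[OF sc1, of "[x]"]] A.refl[of "[t]"]] by simp
      moreover have "([x, t, x], ?F v) \<in> T1" using A.delete[OF uv, of "\<lambda>z. z = x \<or> z = t"] Fu by simp
      ultimately have "([x, t, x], [x, x, t]) \<in> T1" by (metis A.trans append_Cons append_Nil)
      from A.subst[OF this, of "\<lambda>z. if z = x then [0] else [1]"] tx
      have "Mid_Left \<in> laws T1" by (simp add: laws_def)
      with False laws_le show False by blast
    qed
    then show ?thesis unfolding u by (intro B.same_block_gather)
  qed (unfold u, rule B.gather_left)
  also have "(p @ [x, x] @ q @ r, [x, x] @ p @ q @ r) \<in> T2" by (rule B.square_to_front[OF lr])
  also have "([x, x] @ p @ q @ r, [x, x, x] @ p @ q @ r) \<in> T2"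
    using B.mult[OF B.law_instances(4)[OF sc, of "[x]"] B.refl[of "p @ q @ r"]] by simp
  finally (B.trans) show ?thesis using xu by (simp add: u)
qed

text \<open>
  If \<open>x = x\<^sup>2\<close> is in \<open>T2\<close>, only the content matters, since every word is equivalent to the one with all its
  letters cubed. Otherwise both theories preserve simple letters, and nonsimple letters are removed one
  by one; words without nonsimple letters are equal, or permutations of each other if \<open>T2\<close> is commutative.
\<close>
theorem theory_le: "T1 \<subseteq> T2"
proof
  fix e assume "e \<in> T1"
  then obtain u v where e: "e = (u, v)" and uv: "(u, v) \<in> T1" by (cases e) auto
  have "(u, v) \<in> T2"
  proof (cases "Idempotent \<in> laws T2")
    case idem: True
    show ?thesis
    proof (cases "Trivial \<in> laws T2")
      case True
      then show ?thesis using B.law_instances(1) B.sym B.trans by blast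
    next
      case False
      \<comment> \<open>Cubing all letters makes both sides long enough for a rigid identity.\<close>
      let ?c = "\<lambda>w. concat (map (\<lambda>x. [x, x, x]) w)"
      have cube: "(w, ?c w) \<in> T2" for w
      proof (induction w)
        case (Cons x w)
        have "([x] @ w, [x, x, x] @ ?c w) \<in> T2"
        proof (intro B.mult Cons.IH)
          show "([x], [x, x, x]) \<in> T2"
            using B.trans[OF B.law_instances(2)[OF idem, of "[x]"]
                B.mult[OF B.refl[of "[x]"] B.law_instances(2)[OF idem, of "[x]"]]] by simp
        qed
        then show ?case by simp
      qed simp
      have cnt: "count_list (?c w) x = 3 * count_list w x" for w x by (induction w) auto
      have "set u = set v" using A.set_eq[OF uv] False laws_le by blast
      then have "(?c u, ?c v) \<in> rigid_identities"
      proof (intro rigid_identities_frequent)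
        fix x assume "set u = set v" and x: "x \<in> set (?c u)"
        then have "count_list u x \<noteq> 0" "count_list v x \<noteq> 0" unfolding count_list_0_iff by auto
        then show "3 \<le> count_list (?c u) x \<and> 3 \<le> count_list (?c v) x" unfolding cnt by simp
      qed simp
      then show ?thesis using cube[of u] cube[of v] by (meson B.rigid B.sym B.trans)
    qed
  next
    case ni: False
    then have ni1: "Idempotent \<notin> laws T1" using laws_le by blast
    then have nt1: "Trivial \<notin> laws T1" using A.closed_laws unfolding closed_laws_def by blast
    show ?thesis using uv
    proof (rule B.letter_removal_induct)
      fix u v :: word and x :: nat
      assume "(u, v) \<in> T1"
      then show "(removeAll x u, removeAll x v) \<in> T1"
        unfolding removeAll_eq_filter by (rule A.delete)
    next
      fix u v assume uv: "(u, v) \<in> T1" and lin: "\<And>x. count_list u x \<le> 1"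
      have same: "count_list u x = count_list v x" for x
        using A.count_0_iff[OF uv nt1, of x] A.count_1_iff[OF uv ni1, of x] lin[of x] by linarith
      show "(u, v) \<in> T2"
      proof (cases "Commutative \<in> laws T2")
        case True
        then show ?thesis using same by (rule B.permutation_closed)
      next
        case False
        then have "Commutative \<notin> laws T1" using laws_le by blast
        note simple = A.simple_letters_eq[OF uv this]
        have linear: "filter (\<lambda>x. count_list w x = 1) w = w" if "\<And>x. count_list w x \<le> 1" for w :: word
        proof -
          have "count_list w x = 1" if "x \<in> set w" for x
            using that \<open>\<And>x. count_list w x \<le> 1\<close>[of x] by (metis count_list_0_iff le_antisym less_one linorder_not_less)
          then show ?thesis by simp
        qed
        have "u = v"
          using simple unfolding linear[OF lin] linear[OF lin[unfolded same]] .
        then show ?thesis by simp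
      qed
    next
      fix u v x assume uv: "(u, v) \<in> T1" and u2: "count_list u x \<ge> 2"
        and rest: "(removeAll x u, removeAll x v) \<in> T2"
      have v2: "count_list v x \<ge> 2"
        using A.count_0_iff[OF uv nt1, of x] A.count_1_iff[OF uv ni1, of x] u2 by linarith
      show "(u, v) \<in> T2"
      proof (cases "Commutative \<in> laws T2")
        case c: True
        let ?m = "count_list u x" and ?n = "count_list v x"
        have "(replicate ?m x, replicate ?n x) \<in> T2"
        proof (cases "?m = ?n \<or> ?m \<ge> 3 \<and> ?n \<ge> 3")
          case False
          then have "?m = 2 \<and> ?m < ?n \<or> ?n = 2 \<and> ?n < ?m" using u2 v2 by linarith
          then have "Square_Cube \<in> laws T1"
            using A.power_laws(3)[OF A.count_powers[OF uv, of x]]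
              A.power_laws(3)[OF A.sym[OF A.count_powers[OF uv, of x]]] by blast
          then have sc: "Square_Cube \<in> laws T2" using laws_le by blast
          have cube: "(replicate k x, replicate 3 x) \<in> T2" if "k \<ge> 2" for k
          proof (cases "k = 2")
            case True
            then show ?thesis using B.law_instances(4)[OF sc, of "[x]"] by (simp add: numeral_eq_Suc)
          qed (use that in \<open>intro B.high_powers, simp_all\<close>)
          show ?thesis using cube[OF u2] cube[OF v2] by (meson B.sym B.trans)
        qed (use B.high_powers in auto)
        then have "(replicate ?m x @ removeAll x u, replicate ?n x @ removeAll x v) \<in> T2"
          using rest by (rule B.mult)
        then show ?thesis
          using B.commutative_bring_front[OF c, of u x] B.commutative_bring_front[OF c, of v x]
          by (meson B.sym B.trans)
      next
        case nc: False
        show ?thesis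
        proof (cases "count_list u x = 2 \<and> count_list v x = 2")
          case True
          then show ?thesis using reinsert_double_letter[OF nc uv] rest by blast
        next
          case False
          have "(u, [x, x, x] @ removeAll x u) \<in> T2"
            using double_letter_to_front[OF nc uv, of x] B.cube_to_front[of u x] False u2 v2
            by (cases "count_list u x = 2") auto
          moreover have "(v, [x, x, x] @ removeAll x v) \<in> T2"
            using double_letter_to_front[OF nc A.sym[OF uv], of x] B.cube_to_front[of v x] False u2 v2
            by (cases "count_list v x = 2") auto
          moreover have "([x, x, x] @ removeAll x u, [x, x, x] @ removeAll x v) \<in> T2"
            by (intro B.mult B.refl rest)
          ultimately show ?thesis by (meson B.sym B.trans)
        qed
      qed
    qed
  qed
  then show "e \<in> T2" by (simp add: e)
qed

end

section \<open>Varieties and their identities\<close>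

definition identities :: "'a monoid set \<Rightarrow> identity set" where
  "identities V = {e. \<forall>M\<in>V. satisfies M e}"

lemma word_value_simps [simp]:
  "word_value M \<phi> [] = \<one>\<^bsub>M\<^esub>"
  "word_value M \<phi> (x # w) = \<phi> x \<otimes>\<^bsub>M\<^esub> word_value M \<phi> w"
  by (simp_all add: word_value_def)

context monoid
begin

lemma word_value_closed:
  "(\<And>i. \<phi> i \<in> carrier G) \<Longrightarrow> word_value G \<phi> w \<in> carrier G"
  by (induction w) auto

lemma word_value_append:
  "(\<And>i. \<phi> i \<in> carrier G) \<Longrightarrow> word_value G \<phi> (u @ v) = word_value G \<phi> u \<otimes> word_value G \<phi> v"
  by (induction u) (simp_all add: word_value_closed m_assoc)

lemma word_value_substitute:
  assumes "\<And>i. \<phi> i \<in> carrier G"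
  shows "word_value G \<phi> (concat (map \<sigma> w)) = word_value G (\<lambda>i. word_value G \<phi> (\<sigma> i)) w"
  by (induction w) (simp_all add: word_value_append assms)

lemma equational_theory_satisfied: "equational_theory {e. satisfies G e}"
proof
  fix u v and \<sigma> :: "nat \<Rightarrow> word"
  assume "(u, v) \<in> {e. satisfies G e}"
  then show "(concat (map \<sigma> u), concat (map \<sigma> v)) \<in> {e. satisfies G e}"
    by (auto simp: satisfies_def word_value_substitute word_value_closed)
qed (auto simp: satisfies_def word_value_append)

end

lemma equational_theory_INT:
  assumes "\<And>M. M \<in> V \<Longrightarrow> equational_theory (f M)"
  shows "equational_theory (\<Inter>M\<in>V. f M)"
proof
  show "(u, u) \<in> (\<Inter>M\<in>V. f M)" for u using assms by (blast intro: equational_theory.refl)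
  show "(u, v) \<in> (\<Inter>M\<in>V. f M) \<Longrightarrow> (v, u) \<in> (\<Inter>M\<in>V. f M)" for u v
    using assms by (blast intro: equational_theory.sym)
  show "(u, v) \<in> (\<Inter>M\<in>V. f M) \<Longrightarrow> (v, w) \<in> (\<Inter>M\<in>V. f M) \<Longrightarrow> (u, w) \<in> (\<Inter>M\<in>V. f M)" for u v w
    using assms by (blast intro: equational_theory.trans)
  show "(u, u') \<in> (\<Inter>M\<in>V. f M) \<Longrightarrow> (v, v') \<in> (\<Inter>M\<in>V. f M) \<Longrightarrow> (u @ v, u' @ v') \<in> (\<Inter>M\<in>V. f M)"
    for u u' v v' using assms by (blast intro: equational_theory.mult)
  show "(u, v) \<in> (\<Inter>M\<in>V. f M) \<Longrightarrow> (concat (map \<sigma> u), concat (map \<sigma> v)) \<in> (\<Inter>M\<in>V. f M)"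
    for u v \<sigma> using assms by (blast intro: equational_theory.subst)
qed

lemma variety_var [simp, intro]: "variety (var \<Sigma>)"
  by (auto simp: variety_def)

lemma variety_monoid: "variety V \<Longrightarrow> M \<in> V \<Longrightarrow> monoid M"
  by (auto simp: variety_def var_def)

lemma var_identities: "variety V \<Longrightarrow> var (identities V) = V"
  by (auto simp: variety_def var_def identities_def)

lemma identities_antimono: "V \<subseteq> W \<Longrightarrow> identities W \<subseteq> identities V"
  by (auto simp: identities_def)

lemma variety_subset_iff:
  fixes V W :: "'a monoid set"
  assumes "variety V" "variety W"
  shows "V \<subseteq> W \<longleftrightarrow> identities W \<subseteq> identities V"
proof
  assume "identities W \<subseteq> identities V"
  then have "var (identities V) \<subseteq> (var (identities W) :: 'a monoid set)" by (auto simp: var_def)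
  then show "V \<subseteq> W" using assms by (simp add: var_identities)
qed (rule identities_antimono)

lemma equational_theory_identities:
  assumes "variety V"
  shows "equational_theory (identities V)"
proof -
  have "identities V = (\<Inter>M\<in>V. {e. satisfies M e})" by (auto simp: identities_def)
  also have "equational_theory \<dots>"
    using variety_monoid[OF assms] by (intro equational_theory_INT monoid.equational_theory_satisfied)
  finally show ?thesis .
qed

lemma subset_identities_var: "\<Sigma> \<subseteq> identities (var \<Sigma>)"
  by (auto simp: identities_def var_def)

lemma variety_Int:
  assumes "variety A" "variety B"
  shows "variety (A \<inter> B)"
proof -
  have "A \<inter> B = var (identities A) \<inter> var (identities B)" using assms by (simp add: var_identities)
  also have "\<dots> = var (identities A \<union> identities B)" by (auto simp: var_def)
  finally show ?thesis by simp
qed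

lemma variety_join_eq:
  fixes A B :: "'a monoid set"
  assumes "variety A" "variety B"
  shows "A \<or>\<^sub>v B = var (identities A \<inter> identities B)"
proof
  have "A \<subseteq> var (identities A \<inter> identities B)" "B \<subseteq> var (identities A \<inter> identities B)"
    using assms by (auto simp: var_def identities_def variety_monoid)
  then show "A \<or>\<^sub>v B \<subseteq> var (identities A \<inter> identities B)"
    unfolding variety_join_def by blast
  show "var (identities A \<inter> identities B) \<subseteq> A \<or>\<^sub>v B"
    unfolding variety_join_def
  proof (intro Inter_greatest)
    fix V assume V: "V \<in> {V. variety V \<and> A \<subseteq> V \<and> B \<subseteq> V}"
    then have "identities V \<subseteq> identities A \<inter> identities B" by (auto simp: identities_def)
    then have "var (identities A \<inter> identities B) \<subseteq> (var (identities V) :: 'a monoid set)"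
      by (auto simp: var_def)
    then show "var (identities A \<inter> identities B) \<subseteq> V" using V by (simp add: var_identities)
  qed
qed

lemma variety_join:
  assumes "variety A" "variety B"
  shows "variety (A \<or>\<^sub>v B)" "A \<subseteq> A \<or>\<^sub>v B" "B \<subseteq> A \<or>\<^sub>v B"
    "\<lbrakk>variety V; A \<subseteq> V; B \<subseteq> V\<rbrakk> \<Longrightarrow> A \<or>\<^sub>v B \<subseteq> V"
    "identities (A \<or>\<^sub>v B) = identities A \<inter> identities B"
proof -
  show var: "variety (A \<or>\<^sub>v B)" unfolding variety_join_eq[OF assms] by simp
  show sub: "A \<subseteq> A \<or>\<^sub>v B" "B \<subseteq> A \<or>\<^sub>v B" by (auto simp: variety_join_def)
  show "\<lbrakk>variety V; A \<subseteq> V; B \<subseteq> V\<rbrakk> \<Longrightarrow> A \<or>\<^sub>v B \<subseteq> V" by (auto simp: variety_join_def)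
  show "identities (A \<or>\<^sub>v B) = identities A \<inter> identities B"
  proof
    show "identities (A \<or>\<^sub>v B) \<subseteq> identities A \<inter> identities B"
      using sub by (simp add: identities_antimono)
    show "identities A \<inter> identities B \<subseteq> identities (A \<or>\<^sub>v B)"
      unfolding variety_join_eq[OF assms] by (rule subset_identities_var)
  qed
qed

lemma iso_one:
  assumes "monoid M" "monoid N" "h \<in> iso M N"
  shows "h \<one>\<^bsub>M\<^esub> = \<one>\<^bsub>N\<^esub>"
proof -
  interpret M: monoid M by fact
  interpret N: monoid N by fact
  have hom: "\<And>x y. x \<in> carrier M \<Longrightarrow> y \<in> carrier M \<Longrightarrow> h (x \<otimes>\<^bsub>M\<^esub> y) = h x \<otimes>\<^bsub>N\<^esub> h y"
    and img: "h ` carrier M = carrier N"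
    using assms(3) by (auto simp: iso_iff hom_def)
  obtain e where e: "e \<in> carrier M" "h e = \<one>\<^bsub>N\<^esub>" using img N.one_closed by (metis imageE)
  have "h \<one>\<^bsub>M\<^esub> \<in> carrier N" using img by auto
  then have "h \<one>\<^bsub>M\<^esub> = h \<one>\<^bsub>M\<^esub> \<otimes>\<^bsub>N\<^esub> h e" by (simp add: e)
  also have "\<dots> = h e" using hom[OF M.one_closed e(1)] e(1) by simp
  finally show ?thesis using e by simp
qed

lemma satisfies_iso:
  assumes M: "monoid M" and N: "monoid N" and "M \<cong> N"
  shows "satisfies M e \<longleftrightarrow> satisfies N e"
proof -
  interpret M: monoid M by fact
  interpret N: monoid N by fact
  obtain h where h: "h \<in> iso M N" using assms(3) by (auto simp: is_iso_def)
  then have hom: "\<And>x y. x \<in> carrier M \<Longrightarrow> y \<in> carrier M \<Longrightarrow> h (x \<otimes>\<^bsub>M\<^esub> y) = h x \<otimes>\<^bsub>N\<^esub> h y"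
    and img: "h ` carrier M = carrier N" and inj: "inj_on h (carrier M)"
    by (auto simp: iso_iff hom_def)
  have val: "h (word_value M \<phi> w) = word_value N (\<lambda>i. h (\<phi> i)) w" if "\<And>i. \<phi> i \<in> carrier M" for \<phi> w
    using that by (induction w) (simp_all add: iso_one[OF M N h] hom M.word_value_closed)
  have val_eq: "word_value M \<phi> u = word_value M \<phi> v \<longleftrightarrow>
      word_value N (\<lambda>i. h (\<phi> i)) u = word_value N (\<lambda>i. h (\<phi> i)) v"
    if "\<And>i. \<phi> i \<in> carrier M" for \<phi> u v
    using inj_on_eq_iff[OF inj M.word_value_closed[OF that] M.word_value_closed[OF that]]
    by (simp add: val[OF that])
  show ?thesis
  proof
    assume s: "satisfies N e"
    show "satisfies M e"
      unfolding satisfies_def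
    proof (intro allI impI)
      fix \<phi> :: "nat \<Rightarrow> _" assume \<phi>: "\<forall>i. \<phi> i \<in> carrier M"
      then have "\<forall>i. h (\<phi> i) \<in> carrier N" using img by auto
      then have "word_value N (\<lambda>i. h (\<phi> i)) (fst e) = word_value N (\<lambda>i. h (\<phi> i)) (snd e)"
        using s by (simp add: satisfies_def)
      then show "word_value M \<phi> (fst e) = word_value M \<phi> (snd e)" using val_eq \<phi> by blast
    qed
  next
    assume s: "satisfies M e"
    show "satisfies N e"
      unfolding satisfies_def
    proof (intro allI impI)
      fix \<psi> :: "nat \<Rightarrow> _" assume \<psi>: "\<forall>i. \<psi> i \<in> carrier N"
      define \<phi> where "\<phi> i = inv_into (carrier M) h (\<psi> i)" for i
      have \<phi>: "\<phi> i \<in> carrier M" and h\<phi>: "h (\<phi> i) = \<psi> i" for i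
        using \<psi> img by (auto simp: \<phi>_def inv_into_into f_inv_into_f)
      have "word_value M \<phi> (fst e) = word_value M \<phi> (snd e)" using s \<phi> by (simp add: satisfies_def)
      then show "word_value N \<psi> (fst e) = word_value N \<psi> (snd e)"
        using val_eq[OF \<phi>] by (simp add: h\<phi>)
    qed
  qed
qed

text \<open>
  Membership of a finite monoid in a variety over \<open>'a\<close> is witnessed by a copy on a finite subset of \<open>'a\<close>.
  This is the point where \<open>'a\<close> has to be infinite.
\<close>
lemma finite_monoid_copy:
  fixes M :: "'b monoid"
  assumes "infinite (UNIV :: 'a set)" "monoid M" "finite (carrier M)"
  obtains N :: "'a monoid" where "monoid N" "M \<cong> N"
proof -
  interpret M: monoid M by fact
  obtain A :: "'a set" where A: "finite A" "card A = card (carrier M)"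
    using infinite_arbitrarily_large[OF assms(1)] by blast
  then obtain f where f: "bij_betw f (carrier M) A"
    using finite_same_card_bij[OF assms(3) A(1)] by auto
  define g where "g = inv_into (carrier M) f"
  have gf: "g (f x) = x" if "x \<in> carrier M" for x
    using that f by (simp add: g_def bij_betw_def)
  define N :: "'a monoid" where
    "N = \<lparr>carrier = A, mult = \<lambda>x y. f (g x \<otimes>\<^bsub>M\<^esub> g y), one = f \<one>\<^bsub>M\<^esub>\<rparr>"
  have A_eq: "A = f ` carrier M" using f by (simp add: bij_betw_def)
  have "monoid N"
    by unfold_locales (auto simp: N_def A_eq gf M.m_assoc)
  moreover have "f \<in> iso M N"
    using f by (auto simp: iso_def hom_def N_def gf A_eq)
  ultimately show thesis using that is_isoI by blast
qed

lemma generated_variety_eq: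
  fixes M :: "'b monoid"
  assumes "infinite (UNIV :: 'a set)" "monoid M" "finite (carrier M)"
  shows "generated_variety M = (var {e. satisfies M e} :: 'a monoid set)" (is "?G = ?V")
    and "identities (generated_variety M :: 'a monoid set) = {e. satisfies M e}"
proof -
  obtain N :: "'a monoid" where N: "monoid N" "M \<cong> N"
    using finite_monoid_copy[OF assms] .
  have iso: "satisfies K e \<longleftrightarrow> satisfies M e" if "monoid K" "M \<cong> K" for K :: "'a monoid" and e
    using satisfies_iso[OF assms(2) that] by simp
  have NV: "N \<in> ?V" using N iso by (auto simp: var_def)
  show G: "?G = ?V"
  proof
    show "?G \<subseteq> ?V" unfolding generated_variety_def using NV N by blast
    show "?V \<subseteq> ?G"
      unfolding generated_variety_def
    proof (intro Inter_greatest)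
      fix V :: "'a monoid set" assume "V \<in> {V. variety V \<and> (\<exists>N\<in>V. M \<cong> N)}"
      then obtain K where V: "variety V" and K: "K \<in> V" "M \<cong> K" by blast
      have "identities V \<subseteq> {e. satisfies M e}"
        using K iso[OF variety_monoid[OF V K(1)] K(2)] by (auto simp: identities_def)
      then have "?V \<subseteq> var (identities V)" by (auto simp: var_def)
      then show "?V \<subseteq> V" by (simp add: var_identities[OF V])
    qed
  qed
  show "identities ?G = {e. satisfies M e}"
    unfolding G
  proof
    show "identities ?V \<subseteq> {e. satisfies M e}" using NV iso[OF N] by (auto simp: identities_def)
  qed (rule subset_identities_var)
qed

text \<open>
  Refutes identities of a variety given by axioms: a finite model of the axioms, on any type, has a copy
  in the variety.
\<close>
lemma identities_model:
  fixes M :: "'b monoid" and V :: "'a monoid set"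
  assumes "infinite (UNIV :: 'a set)" "monoid M" "finite (carrier M)"
    and "V = var \<Sigma>" "\<And>e. e \<in> \<Sigma> \<Longrightarrow> satisfies M e" "e \<in> identities V"
  shows "satisfies M e"
proof -
  obtain N :: "'a monoid" where N: "monoid N" "M \<cong> N"
    using finite_monoid_copy[OF assms(1-3)] .
  note iso = satisfies_iso[OF assms(2) N]
  have "N \<in> V" using N assms(4,5) iso by (auto simp: var_def)
  then show ?thesis using assms(6) iso by (auto simp: identities_def)
qed

lemma opposite_opposite [simp]: "opposite (opposite M) = M"
  by (simp add: opposite_def)

lemma carrier_opposite [simp]: "carrier (opposite M) = carrier M"
  and one_opposite [simp]: "\<one>\<^bsub>opposite M\<^esub> = \<one>\<^bsub>M\<^esub>"
  and mult_opposite [simp]: "x \<otimes>\<^bsub>opposite M\<^esub> y = y \<otimes>\<^bsub>M\<^esub> x"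
  by (simp_all add: opposite_def)

lemma monoid_opposite: "monoid M \<Longrightarrow> monoid (opposite M)"
proof -
  assume "monoid M"
  then interpret monoid M .
  show ?thesis by unfold_locales (simp_all add: m_assoc)
qed

definition reverse_identity :: "identity \<Rightarrow> identity" where
  "reverse_identity e = (rev (fst e), rev (snd e))"

lemma reverse_identity_simps [simp]:
  "reverse_identity (u, v) = (rev u, rev v)" "reverse_identity (reverse_identity e) = e"
  by (simp_all add: reverse_identity_def)

lemma satisfies_opposite:
  assumes "monoid M"
  shows "satisfies (opposite M) e \<longleftrightarrow> satisfies M (reverse_identity e)"
proof -
  have "word_value (opposite M) \<phi> w = word_value M \<phi> (rev w)" if "\<forall>i. \<phi> i \<in> carrier M" for \<phi> w
    using that monoid.r_one[OF assms]
    by (induction w) (simp_all add: monoid.word_value_append[OF assms])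
  then show ?thesis by (simp add: satisfies_def reverse_identity_def)
qed

lemma identities_dual:
  assumes "variety V"
  shows "identities (dual_variety V) = {e. reverse_identity e \<in> identities V}"
  using variety_monoid[OF assms] by (auto simp: identities_def dual_variety_def satisfies_opposite)

lemma variety_dual:
  fixes V :: "'a monoid set"
  assumes "variety V"
  shows "variety (dual_variety V)"
proof -
  have "dual_variety V = var (reverse_identity ` identities V)"
  proof
    show "dual_variety V \<subseteq> var (reverse_identity ` identities V)"
      using variety_monoid[OF assms]
      by (auto simp: var_def dual_variety_def satisfies_opposite monoid_opposite identities_def)
    show "var (reverse_identity ` identities V) \<subseteq> dual_variety V"
    proof
      fix M :: "'a monoid" assume M: "M \<in> var (reverse_identity ` identities V)"
      then have "monoid M" by (simp add: var_def)
      with M have "opposite M \<in> var (identities V)"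
        by (auto simp: var_def satisfies_opposite monoid_opposite)
      then have "opposite M \<in> V" by (simp add: var_identities[OF assms])
      then show "M \<in> dual_variety V" unfolding dual_variety_def by (metis image_eqI opposite_opposite)
    qed
  qed
  then show ?thesis by simp
qed

section \<open>Monoids of words with zero\<close>

definition zero_relators :: "'g list set \<Rightarrow> ('g zword \<times> 'g zword) set" where
  "zero_relators W = (\<lambda>w. (Some w, None)) ` W"

abbreviation factor_monoid :: "'g list set \<Rightarrow> 'g zword set monoid" where
  "factor_monoid W \<equiv> presented_monoid (zero_relators W)"

definition nonzero :: "'g list set \<Rightarrow> 'g list \<Rightarrow> bool" where
  "nonzero W u \<longleftrightarrow> \<not> (\<exists>w\<in>W. sublist w u)"

abbreviation element :: "'g list set \<Rightarrow> 'g zword \<Rightarrow> 'g zword set" where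
  "element W u \<equiv> generated_congruence (zero_relators W) `` {u}"

lemma element_eq_iff:
  "element W (Some u) = element W (Some v) \<longleftrightarrow> u = v \<or> \<not> nonzero W u \<and> \<not> nonzero W v"
  "element W (Some u) = element W None \<longleftrightarrow> \<not> nonzero W u"
proof -
  let ?C = "generated_congruence (zero_relators W)"
  have zero: "element W (Some u) = element W None" if "\<not> nonzero W u" for u
  proof -
    obtain p w s where w: "w \<in> W" and u: "u = p @ w @ s"
      using \<open>\<not> nonzero W u\<close> by (auto simp: nonzero_def sublist_def)
    have "(Some w, None) \<in> ?C"
      using w by (auto simp: zero_relators_def intro: generated_congruence.base)
    from generated_congruence.mult[OF generated_congruence.refl[of "Some p"]
        generated_congruence.mult[OF this generated_congruence.refl[of "Some s"]]]
    have "(Some u, None) \<in> ?C" by (simp add: u)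
    then show ?thesis by (blast intro: generated_congruence.sym generated_congruence.trans)
  qed
  have "inj_on (element W) (insert None (Some ` {u. nonzero W u}))"
    using inj_on_generated_congruence[OF zero_relators_def] by (simp add: nonzero_def)
  then have inj: "u = v" if "element W u = element W v"
    "u \<in> insert None (Some ` {u. nonzero W u})" "v \<in> insert None (Some ` {u. nonzero W u})" for u v
    using that by (blast dest: inj_onD)
  show None: "element W (Some u) = element W None \<longleftrightarrow> \<not> nonzero W u" for u
    using zero[of u] inj[of "Some u" None] by blast
  show "element W (Some u) = element W (Some v) \<longleftrightarrow> u = v \<or> \<not> nonzero W u \<and> \<not> nonzero W v"
    using zero[of u] zero[of v] inj[of "Some u" "Some v"] None[of u] None[of v] by auto
qed

lemma monoid_factor_monoid: "monoid (factor_monoid W)"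
  by (rule monoid_presented_monoid[OF zero_relators_def])

lemma carrier_factor_monoid:
  "carrier (factor_monoid W) = element W ` insert None (Some ` {u. nonzero W u})"
  using carrier_presented_monoid[OF zero_relators_def] by (simp add: nonzero_def)

lemma element_in_carrier: "element W u \<in> carrier (factor_monoid W)"
  by (auto simp: presented_monoid_def quotient_def)

lemma word_value_factor_monoid:
  "word_value (factor_monoid W) (\<lambda>i. element W (f i)) u = element W (foldr zmult (map f u) (Some []))"
proof (induction u)
  case Nil
  show ?case by (simp add: presented_monoid_def)
qed (simp add: presented_monoid_mult_class[OF zero_relators_def])

lemma foldr_zmult_Some: "foldr zmult (map (\<lambda>i. Some (g i)) u) (Some []) = Some (concat (map g u))"
  by (induction u) simp_all

lemma foldr_zmult_None:
  assumes "i \<in> set u" "f i = None"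
  shows "foldr zmult (map f u) (Some []) = None"
proof -
  have "zmult x None = None" for x :: "'a zword" by (cases x) simp_all
  then show ?thesis using assms by (induction u) auto
qed

text \<open>
  Substituting zero for a letter makes both sides zero when they have the same letters, so only
  substitutions of nonzero words matter.
\<close>
lemma satisfies_factor_monoid_iff:
  assumes "set u = set v"
  shows "satisfies (factor_monoid W) (u, v) \<longleftrightarrow>
    (\<forall>g. (\<forall>i. nonzero W (g i)) \<longrightarrow> concat (map g u) = concat (map g v) \<or>
      \<not> nonzero W (concat (map g u)) \<and> \<not> nonzero W (concat (map g v)))" (is "_ \<longleftrightarrow> ?R")
proof
  assume s: "satisfies (factor_monoid W) (u, v)"
  show ?R
  proof (intro allI impI)
    fix g
    have "element W (Some (concat (map g u))) = element W (Some (concat (map g v)))"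
      using s element_in_carrier[of W] word_value_factor_monoid[of W "\<lambda>i. Some (g i)"]
      unfolding foldr_zmult_Some satisfies_def by (metis fst_conv snd_conv)
    then show "concat (map g u) = concat (map g v) \<or>
      \<not> nonzero W (concat (map g u)) \<and> \<not> nonzero W (concat (map g v))"
      unfolding element_eq_iff(1) .
  qed
next
  assume R: ?R
  show "satisfies (factor_monoid W) (u, v)"
    unfolding satisfies_def fst_conv snd_conv
  proof (intro allI impI)
    fix \<phi> :: "nat \<Rightarrow> _" assume "\<forall>i. \<phi> i \<in> carrier (factor_monoid W)"
    then have "\<forall>i. \<exists>f. \<phi> i = element W f \<and> (\<forall>w. f = Some w \<longrightarrow> nonzero W w)"
      unfolding carrier_factor_monoid by fast
    then obtain f where \<phi>: "\<phi> = (\<lambda>i. element W (f i))" and f: "\<And>i w. f i = Some w \<Longrightarrow> nonzero W w"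
      by metis
    show "word_value (factor_monoid W) \<phi> u = word_value (factor_monoid W) \<phi> v"
    proof (cases "\<exists>i\<in>set u. f i = None")
      case True
      then obtain i where i: "i \<in> set u" "f i = None" by blast
      then have "i \<in> set v" using assms by simp
      then show ?thesis unfolding \<phi> word_value_factor_monoid
        using foldr_zmult_None[of i u f] foldr_zmult_None[of i v f] i by simp
    next
      case some: False
      show ?thesis
      proof (cases "u = []")
        case True
        then show ?thesis using assms by simp
      next
        case False
        then have "f (hd u) \<noteq> None" using some by simp
        then obtain w where w: "nonzero W w" using f by blast
        define g where "g i = (case f i of None \<Rightarrow> w | Some w' \<Rightarrow> w')" for i
        have g: "nonzero W (g i)" for i using f[of i] w by (auto simp: g_def split: option.split)
        have fg: "f i = Some (g i)" if "i \<in> set u" for i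
          using some that by (auto simp: g_def split: option.split)
        have "map f u = map (\<lambda>i. Some (g i)) u" "map f v = map (\<lambda>i. Some (g i)) v"
          using fg assms by auto
        then show ?thesis
          using R[rule_format, of g] g
          unfolding \<phi> word_value_factor_monoid by (simp only: foldr_zmult_Some element_eq_iff(1))
      qed
    qed
  qed
qed

text \<open>
  If the value of \<open>u\<close> is a nonzero word, then it has length at most 3, and so has the projection of \<open>u\<close>
  to the letters with nonempty values. That projection is rigid, hence also a projection of \<open>v\<close>, and the
  values agree.
\<close>
lemma rigid_identities_factor_monoid:
  assumes "\<And>w. nonzero W w \<Longrightarrow> rigid w"
  shows "rigid_identities \<subseteq> {e. satisfies (factor_monoid W) e}"
proof
  fix e assume e: "e \<in> rigid_identities"
  obtain u v where [simp]: "e = (u, v)" by (cases e)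
  have rigid: "concat (map g u) = concat (map g v)" if "(u, v) \<in> rigid_identities"
    and nz: "nonzero W (concat (map g u))" for g :: "nat \<Rightarrow> 'a list" and u v
  proof -
    let ?F = "filter (\<lambda>i. g i \<noteq> [])"
    have concat_F: "concat (map g w) = concat (map g (?F w))" for w
      by (induction w) auto
    have len: "length w \<le> length (concat (map g w))" if "\<And>i. i \<in> set w \<Longrightarrow> g i \<noteq> []" for w
      using that
    proof (induction w)
      case (Cons i w)
      have "length (g i) > 0" using Cons.prems[of i] by simp
      moreover have "length w \<le> length (concat (map g w))"
        by (rule Cons.IH) (rule Cons.prems, simp)
      ultimately show ?case
        unfolding list.map concat.simps length_append length_Cons by linarith
    qed simp
    have r: "rigid (concat (map g (?F u)))" using assms[OF nz] concat_F[of u] by simp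
    have "length (?F u) \<le> 3"
      using len[of "?F u"] r unfolding rigid_def by auto
    moreover have "?F u \<noteq> [i, i, i]" for i
    proof
      assume F: "?F u = [i, i, i]"
      then have "i \<in> set (?F u)" by simp
      then have "length (g i) > 0" by simp
      moreover have "3 * length (g i) \<le> 3" using r unfolding F by (auto simp: rigid_def)
      ultimately have "length (g i) = 1" by linarith
      then obtain c where "g i = [c]" by (auto simp: length_Suc_conv)
      then show False using r unfolding F by (auto simp: rigid_def)
    qed
    ultimately have "rigid (?F u)" by (auto simp: rigid_def)
    then have "?F u = ?F v" using rigid_identitiesD[OF that(1), of "\<lambda>i. g i \<noteq> []"] by blast
    then show ?thesis using concat_F[of u] concat_F[of v] by simp
  qed
  have uv: "(u, v) \<in> rigid_identities" using e by simp
  have "count_list u x = 0 \<longleftrightarrow> count_list v x = 0" for x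
    using rigid_identities_count[OF uv, of x] by auto
  then have "set u = set v" by (auto simp: count_list_0_iff)
  moreover have "concat (map g u) = concat (map g v) \<or>
      \<not> nonzero W (concat (map g u)) \<and> \<not> nonzero W (concat (map g v))" for g
    using rigid[OF uv, of g] rigid[OF rigid_identities_sym[OF uv], of g] by fastforce
  ultimately show "e \<in> {e. satisfies (factor_monoid W) e}"
    by (simp add: satisfies_factor_monoid_iff)
qed

lemma rigid_theory_factor_monoid:
  assumes "\<And>w. nonzero W w \<Longrightarrow> rigid w"
  shows "rigid_theory {e. satisfies (factor_monoid W) e}"
  using rigid_identities_factor_monoid[of W] assms
    monoid.equational_theory_satisfied[OF monoid_factor_monoid[of W]]
  by (simp add: rigid_theory_def rigid_theory_axioms_def)

lemma finite_factor_monoid: "finite {w. nonzero W w} \<Longrightarrow> finite (carrier (factor_monoid W))"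
  by (simp add: carrier_factor_monoid)

text \<open>
  The relators of the small monoids: over one generator \<open>a\<close> the relator \<open>a\<^sup>n\<close>, over two generators those
  of the monoids whose longest nonzero words are \<open>ab\<close>, \<open>aba\<close> and \<open>aab\<close>.
\<close>
definition power_relator :: "nat \<Rightarrow> unit list set" where
  "power_relator n = {replicate n ()}"

definition ab_relators :: "letter list set" where
  "ab_relators = {[La, La], [Lb, Lb], [Lb, La]}"

definition aba_relators :: "letter list set" where
  "aba_relators = {[La, La], [Lb, Lb], [Lb, La, Lb]}"

definition aab_relators :: "letter list set" where
  "aab_relators = {[La, La, La], [Lb, Lb], [Lb, La]}"

lemma D2_monoid_factor_monoid: "D2_monoid = factor_monoid aba_relators"
  by (simp add: D2_monoid_def zero_relators_def aba_relators_def)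

lemma R_monoid_factor_monoid: "R_monoid = factor_monoid aab_relators"
  by (simp add: R_monoid_def zero_relators_def aab_relators_def)

lemma nonzero_power_relator: "nonzero (power_relator n) w \<longleftrightarrow> length w < n"
proof -
  have w: "w = replicate (length w) ()" by (metis (full_types) old.unit.exhaust replicate_eqI)
  have "sublist (replicate n ()) w \<longleftrightarrow> n \<le> length w"
  proof
    assume "n \<le> length w"
    then have "w = [] @ replicate n () @ replicate (length w - n) ()"
      using w by (metis append_Nil le_add_diff_inverse replicate_add)
    then show "sublist (replicate n ()) w" unfolding sublist_def by blast
  qed (auto dest: sublist_length_le)
  then show ?thesis by (auto simp: nonzero_def power_relator_def)
qed

lemma nonzero_aba_relators: "nonzero aba_relators w \<longleftrightarrow>
    w \<in> {[], [La], [Lb], [La, Lb], [Lb, La], [La, Lb, La]}"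
  using arg_cong[OF D2_words, of "\<lambda>A. w \<in> A"]
  unfolding nonzero_def aba_relators_def mem_Collect_eq .

lemma nonzero_aab_relators: "nonzero aab_relators w \<longleftrightarrow>
    w \<in> {[], [La], [Lb], [La, La], [La, Lb], [La, La, Lb]}"
  using arg_cong[OF R_words, of "\<lambda>A. w \<in> A"]
  unfolding nonzero_def aab_relators_def mem_Collect_eq .

lemma nonzero_ab_relators: "nonzero ab_relators w \<longleftrightarrow> w \<in> {[], [La], [Lb], [La, Lb]}"
proof
  show "w \<in> {[], [La], [Lb], [La, Lb]} \<Longrightarrow> nonzero ab_relators w"
    by (auto simp: nonzero_def ab_relators_def sublist_Cons_right)
  show "nonzero ab_relators w \<Longrightarrow> w \<in> {[], [La], [Lb], [La, Lb]}"
  proof (induction w)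
    case (Cons c w)
    then have "w \<in> {[], [La], [Lb], [La, Lb]}"
      by (simp add: nonzero_def sublist_Cons_right)
    with Cons.prems show ?case
      by (cases c) (auto simp: nonzero_def ab_relators_def sublist_Cons_right)
  qed simp
qed

lemma rigid_nonzero:
  "n \<le> 3 \<Longrightarrow> nonzero (power_relator n) v \<Longrightarrow> rigid v"
  "nonzero ab_relators w \<Longrightarrow> rigid w"
  "nonzero aba_relators w \<Longrightarrow> rigid w"
  "nonzero aab_relators w \<Longrightarrow> rigid w"
  by (auto simp: nonzero_power_relator nonzero_ab_relators nonzero_aba_relators
      nonzero_aab_relators rigid_def)

lemma finite_nonzero: "finite {w. nonzero (power_relator n) w}" "finite {w. nonzero ab_relators w}"
  "finite {w. nonzero aba_relators w}" "finite {w. nonzero aab_relators w}"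
proof -
  have "{w :: unit list. length w < n} \<subseteq> (\<lambda>k. replicate k ()) ` {..<n}"
    by (auto intro!: image_eqI[of _ _ "length _"] replicate_eqI)
  then show "finite {w. nonzero (power_relator n) w}"
    unfolding nonzero_power_relator by (rule finite_subset) simp
qed (simp_all add: nonzero_ab_relators nonzero_aba_relators nonzero_aab_relators)

text \<open>
  Turns a law into a statement about the finitely many pairs of nonzero words.
\<close>
lemma law_factor_monoid_iff:
  assumes "l \<noteq> Trivial"
  shows "satisfies (factor_monoid W) (law_identity l) \<longleftrightarrow>
    (\<forall>s t. nonzero W s \<longrightarrow> nonzero W t \<longrightarrow>
      (let u = concat (map (\<lambda>i. if i = 0 then s else t) (fst (law_identity l)));
           v = concat (map (\<lambda>i. if i = 0 then s else t) (snd (law_identity l)))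
       in u = v \<or> \<not> nonzero W u \<and> \<not> nonzero W v))" (is "?L \<longleftrightarrow> ?R")
proof -
  let ?u = "fst (law_identity l)" and ?v = "snd (law_identity l)"
  have letters: "set ?u = set ?v" "set ?u \<subseteq> {0, 1}" using assms by (cases l; auto)+
  have sat: "?L \<longleftrightarrow> (\<forall>g. (\<forall>i. nonzero W (g i)) \<longrightarrow> concat (map g ?u) = concat (map g ?v) \<or>
      \<not> nonzero W (concat (map g ?u)) \<and> \<not> nonzero W (concat (map g ?v)))"
    using satisfies_factor_monoid_iff[OF letters(1), of W] by simp
  show ?thesis
  proof
    assume L: ?L
    show ?R
      unfolding Let_def
    proof (intro allI impI)
      fix s t assume "nonzero W s" "nonzero W t"
      then show "concat (map (\<lambda>i. if i = 0 then s else t) ?u) =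
          concat (map (\<lambda>i. if i = 0 then s else t) ?v) \<or>
          \<not> nonzero W (concat (map (\<lambda>i. if i = 0 then s else t) ?u)) \<and>
          \<not> nonzero W (concat (map (\<lambda>i. if i = 0 then s else t) ?v))"
        using L[unfolded sat, rule_format, of "\<lambda>i. if i = 0 then s else t"] by simp
    qed
  next
    assume R: ?R
    show ?L
      unfolding sat
    proof (intro allI impI)
      fix g :: "nat \<Rightarrow> _" assume g: "\<forall>i. nonzero W (g i)"
      have map_g: "map g w = map (\<lambda>i. if i = 0 then g 0 else g 1) w" if "set w \<subseteq> {0, 1}" for w
        using that by (intro map_cong) auto
      have "set ?v \<subseteq> {0, 1}" using letters by simp
      note map_g = map_g[OF letters(2)] map_g[OF this]
      show "concat (map g ?u) = concat (map g ?v) \<or>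
          \<not> nonzero W (concat (map g ?u)) \<and> \<not> nonzero W (concat (map g ?v))"
        unfolding map_g using R[unfolded Let_def, rule_format, of "g 0" "g 1"] g by blast
    qed
  qed
qed

lemmas law_factor_monoid_iffs =
  law_factor_monoid_iff[of Idempotent, simplified Let_def, simplified] law_factor_monoid_iff[of Commutative, simplified Let_def, simplified]
  law_factor_monoid_iff[of Square_Cube, simplified Let_def, simplified] law_factor_monoid_iff[of Mid_Left, simplified Let_def, simplified]
  law_factor_monoid_iff[of Mid_Right, simplified Let_def, simplified]

lemma power_relator_laws:
  "\<not> satisfies (factor_monoid (power_relator 2)) (law_identity Idempotent)"
  "\<not> satisfies (factor_monoid (power_relator 3)) (law_identity Square_Cube)"
  "satisfies (factor_monoid (power_relator n)) (law_identity Commutative)"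
proof -
  have unit_list: "u = v" if "length u = length v" for u v :: "unit list"
    using that by (metis (full_types) nth_equalityI old.unit.exhaust)
  show "\<not> satisfies (factor_monoid (power_relator 2)) (law_identity Idempotent)"
    by (auto simp: law_factor_monoid_iffs nonzero_power_relator intro!: exI[of _ "[()]"])
  show "\<not> satisfies (factor_monoid (power_relator 3)) (law_identity Square_Cube)"
    by (auto simp: law_factor_monoid_iffs nonzero_power_relator intro!: exI[of _ "[()]"])
  show "satisfies (factor_monoid (power_relator n)) (law_identity Commutative)"
    by (auto simp: law_factor_monoid_iffs nonzero_power_relator intro: unit_list)
qed

lemma not_satisfies_trivial: "\<not> satisfies (factor_monoid (power_relator 1)) (law_identity Trivial)"
proof
  let ?W = "power_relator 1"
  assume "satisfies (factor_monoid ?W) (law_identity Trivial)"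
  from this[unfolded satisfies_def law_identity.simps fst_conv snd_conv, rule_format,
      of "\<lambda>i. element ?W None", OF element_in_carrier]
  have "element ?W None = element ?W (Some [])"
    unfolding word_value_factor_monoid by simp
  then show False using element_eq_iff(2)[of ?W "[]"] by (simp add: nonzero_power_relator)
qed

lemma power_relator_1_idempotent: "satisfies (factor_monoid (power_relator 1)) (law_identity Idempotent)"
  by (auto simp: law_factor_monoid_iffs nonzero_power_relator)

lemma ab_relators_laws:
  "\<not> satisfies (factor_monoid ab_relators) (law_identity Commutative)"
  "satisfies (factor_monoid ab_relators) (law_identity Square_Cube)"
  "satisfies (factor_monoid ab_relators) (law_identity Mid_Left)"
  "satisfies (factor_monoid ab_relators) (law_identity Mid_Right)"
  by (auto simp: law_factor_monoid_iffs nonzero_ab_relators)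

lemma aba_relators_laws:
  "satisfies (factor_monoid aba_relators) (law_identity Square_Cube)"
  "\<not> satisfies (factor_monoid aba_relators) (law_identity Mid_Left)"
  by (auto simp: law_factor_monoid_iffs nonzero_aba_relators)

lemma aab_relators_laws:
  "satisfies (factor_monoid aab_relators) (law_identity Mid_Right)"
  "\<not> satisfies (factor_monoid aab_relators) (law_identity Mid_Left)"
  "\<not> satisfies (factor_monoid aab_relators) (law_identity Square_Cube)"
  by (auto simp: law_factor_monoid_iffs nonzero_aab_relators)

section \<open>The laws of the varieties\<close>

lemma rigid_identities_linear:
  assumes uv: "(u, v) \<in> rigid_identities" and lin: "\<And>x. count_list u x \<le> 1"
  shows "u = v"
proof (rule distinct_eq_by_pairs)
  have same: "count_list u x = count_list v x" for x
    using rigid_identities_count[OF uv, of x] lin[of x] by auto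
  show du: "distinct u" using lin by (rule distinct_if_count_le_1)
  show "distinct v" using lin unfolding same by (rule distinct_if_count_le_1)
  have "x \<in> set u \<longleftrightarrow> x \<in> set v" for x using same[of x] by (metis count_list_0_iff)
  then show "set u = set v" by blast
  fix x y :: nat assume "x \<noteq> y"
  let ?F = "filter (\<lambda>z. z = x \<or> z = y)"
  have "length (?F u) = count_list u x + count_list u y" using \<open>x \<noteq> y\<close> by (induction u) auto
  then have "length (?F u) \<le> 2" using lin[of x] lin[of y] by simp
  then have "rigid (?F u)" by (auto simp: rigid_def)
  then show "?F u = ?F v" using rigid_identitiesD[OF uv] by blast
qed

context equational_theory
begin

lemma absorb_into_square:
  assumes sc: "Square_Cube \<in> laws T" and lr: "Left_Right \<in> laws T"
  shows "[x, x] @ w \<approx> [x, x] @ removeAll x w"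
proof (induction w)
  case (Cons y w)
  show ?case
  proof (cases "y = x")
    case True
    have "[x, x] @ [x] @ w \<approx> [x, x] @ w"
      using mult[OF sym[OF law_instances(4)[OF sc, of "[x]"]] refl[of w]] by simp
    also note Cons.IH
    finally (trans) show ?thesis using True by simp
  next
    case False
    have swap: "[x, x] @ [y] @ w \<approx> [y] @ [x, x] @ w" for w
      using mult[OF law_instances(7)[OF lr, of "[x]" "[y]"] refl[of w]] by simp
    have "[x, x] @ [y] @ w \<approx> [y] @ [x, x] @ w" by (rule swap)
    also have "[y] @ [x, x] @ w \<approx> [y] @ [x, x] @ removeAll x w" by (intro mult refl Cons.IH)
    also have "[y] @ [x, x] @ removeAll x w \<approx> [x, x] @ [y] @ removeAll x w" by (rule sym[OF swap])
    finally show ?thesis using False by simp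
  qed
qed simp

lemma square_to_front_if_mid:
  assumes sc: "Square_Cube \<in> laws T" and ml: "Mid_Left \<in> laws T" and lr: "Left_Right \<in> laws T"
    and c: "count_list u x \<ge> 2"
  shows "u \<approx> [x, x] @ removeAll x u"
proof -
  have "x \<in> set u" using c by (metis count_list_0_iff not_numeral_le_zero)
  then obtain p s where u: "u = p @ x # s" and p: "x \<notin> set p" by (metis split_list_first)
  then have "count_list s x \<ge> 1" using c by (simp add: count_list_0_iff)
  then have "x \<in> set s" by (metis count_list_0_iff not_one_le_zero)
  then obtain q r where s: "s = q @ x # r" by (metis split_list_first)
  have "u \<approx> p @ [x, x] @ q @ r"
    using context_closed[OF law_instances(5)[OF ml, of "[x]" q], of p r] by (simp add: u s)
  also have "p @ [x, x] @ q @ r \<approx> [x, x] @ p @ q @ r"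
    using context_closed[OF sym[OF law_instances(7)[OF lr, of "[x]" p]], of "[]" "q @ r"] by simp
  also have "[x, x] @ p @ q @ r \<approx> [x, x] @ removeAll x (p @ q @ r)"
    by (rule absorb_into_square[OF sc lr])
  finally show ?thesis by (simp add: u s)
qed

text \<open>
  For the variety \<open>\<^bold>D\<close>, given by axioms: a nonsimple letter can be collected into a square in front of the
  word, and this normal form depends only on the letters and the order of the simple ones.
\<close>
lemma rigid_theory_if_square_cube_mid:
  assumes "Square_Cube \<in> laws T" "Mid_Left \<in> laws T" "Left_Right \<in> laws T"
  shows "rigid_theory T"
proof
  show "rigid_identities \<subseteq> T"
  proof
    fix e assume "e \<in> rigid_identities"
    moreover obtain u v where "e = (u, v)" by (cases e)
    ultimately have "(u, v) \<in> rigid_identities" by simp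
    then have "u \<approx> v"
    proof (rule letter_removal_induct)
      fix u v x assume uv: "(u, v) \<in> rigid_identities" and u: "count_list u x \<ge> 2"
        and rest: "removeAll x u \<approx> removeAll x v"
      have v: "count_list v x \<ge> 2" using rigid_identities_count[OF uv, of x] u by auto
      have "[x, x] @ removeAll x u \<approx> [x, x] @ removeAll x v" by (intro mult refl rest)
      then show "u \<approx> v"
        using square_to_front_if_mid[OF assms u] square_to_front_if_mid[OF assms v] by (meson sym trans)
    qed (auto simp: removeAll_eq_filter intro: rigid_identities_filter dest: rigid_identities_linear)
    then show "e \<in> T" by (simp add: \<open>e = (u, v)\<close>)
  qed
qed

text \<open>
  For commutative varieties with \<open>x\<^sup>3 = x\<^sup>4\<close>: a word is determined by the number of occurrences of each
  letter up to 3, and rigid identities preserve these numbers.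
\<close>
lemma rigid_theory_if_commutative:
  assumes c: "Commutative \<in> laws T" and cube: "replicate 3 0 \<approx> replicate 4 0"
  shows "rigid_theory T"
proof
  have power: "replicate n x \<approx> replicate 3 x" if "n \<ge> 3" for n x
    using that
  proof (induction n rule: dec_induct)
    case (step n)
    have "replicate 3 x \<approx> replicate 4 x" using subst[OF cube, of "\<lambda>_. [x]"] by (simp add: numeral_eq_Suc)
    have "[x] @ replicate n x \<approx> [x] @ replicate 3 x" by (intro mult refl step.IH)
    then have "replicate (Suc n) x \<approx> replicate 4 x" by (simp add: numeral_eq_Suc)
    with \<open>replicate 3 x \<approx> replicate 4 x\<close> show ?case by (meson sym trans)
  qed simp
  show "rigid_identities \<subseteq> T"
  proof
    fix e assume "e \<in> rigid_identities"
    moreover obtain u v where "e = (u, v)" by (cases e)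
    ultimately have "(u, v) \<in> rigid_identities" by simp
    then have "u \<approx> v"
    proof (rule letter_removal_induct)
      fix u v x assume uv: "(u, v) \<in> rigid_identities" and rest: "removeAll x u \<approx> removeAll x v"
      have "replicate (count_list u x) x \<approx> replicate (count_list v x) x"
      proof (cases "count_list u x = count_list v x")
        case False
        then have "count_list u x \<ge> 3" "count_list v x \<ge> 3"
          using rigid_identities_count[OF uv, of x] by auto
        then show ?thesis using power by (meson sym trans)
      qed simp
      then have "replicate (count_list u x) x @ removeAll x u \<approx> replicate (count_list v x) x @ removeAll x v"
        by (intro mult rest)
      then show "u \<approx> v"
        using commutative_bring_front[OF c, of u x] commutative_bring_front[OF c, of v x] by (meson sym trans)
    qed (auto simp: removeAll_eq_filter intro: rigid_identities_filter dest: rigid_identities_linear)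
    then show "e \<in> T" by (simp add: \<open>e = (u, v)\<close>)
  qed
qed

end

text \<open>
  These turn out to be the subvarieties of \<open>\<^bold>R \<or> \<^bold>R\<^sup>\<delta>\<close>. The condition does not mention the largest of
  them, so that it can be checked for each variety separately.
\<close>
definition rigid_variety :: "'a monoid set \<Rightarrow> bool" where
  "rigid_variety V \<longleftrightarrow> variety V \<and> rigid_identities \<subseteq> identities V"

abbreviation laws_of :: "'a monoid set \<Rightarrow> law set" where
  "laws_of V \<equiv> laws (identities V)"

lemma rigid_varietyI: "variety V \<Longrightarrow> rigid_theory (identities V) \<Longrightarrow> rigid_variety V"
  by (simp add: rigid_variety_def rigid_theory_def rigid_theory_axioms_def)

lemma rigid_theory_identities: "rigid_variety V \<Longrightarrow> rigid_theory (identities V)"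
  by (simp add: rigid_variety_def rigid_theory_def rigid_theory_axioms_def equational_theory_identities)

lemma rigid_variety_subset: "rigid_variety V \<Longrightarrow> variety W \<Longrightarrow> W \<subseteq> V \<Longrightarrow> rigid_variety W"
  using identities_antimono[of W V] by (auto simp: rigid_variety_def)

lemma closed_laws_of: "rigid_variety V \<Longrightarrow> closed_laws (laws_of V)"
  by (intro rigid_theory.closed_laws rigid_theory_identities)

text \<open>
  The order between varieties is read off the finite sets of laws.
\<close>
lemma rigid_variety_subset_iff:
  fixes V W :: "'a monoid set"
  assumes "rigid_variety V" "rigid_variety W"
  shows "V \<subseteq> W \<longleftrightarrow> laws_of W \<subseteq> laws_of V"
proof -
  have "identities W \<subseteq> identities V" if "laws_of W \<subseteq> laws_of V"
  proof (rule theory_pair.theory_le)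
    show "theory_pair (identities W) (identities V)"
      using assms that by (simp add: theory_pair_def theory_pair_axioms_def rigid_theory_identities)
  qed
  moreover have "laws_of W \<subseteq> laws_of V" if "identities W \<subseteq> identities V"
    using that by (auto simp: laws_def)
  ultimately show ?thesis
    using assms by (auto simp: variety_subset_iff rigid_variety_def)
qed

lemma rigid_variety_join:
  fixes V W :: "'a monoid set"
  assumes "rigid_variety V" "rigid_variety W"
  shows "rigid_variety (V \<or>\<^sub>v W)" "laws_of (V \<or>\<^sub>v W) = laws_of V \<inter> laws_of W"
  using assms by (auto simp: rigid_variety_def variety_join laws_def)

lemma rigid_variety_dual:
  fixes V :: "'a monoid set"
  assumes "rigid_variety V"
  shows "rigid_variety (dual_variety V)"
  using assms rigid_identities_rev unfolding rigid_variety_def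
  by (auto simp: variety_dual identities_dual reverse_identity_def)

lemma generated_variety_laws:
  assumes inf: "infinite (UNIV :: 'a set)"
    and W: "finite {w. nonzero W w}" "\<And>w. nonzero W w \<Longrightarrow> rigid w"
  defines "V \<equiv> generated_variety (factor_monoid W) :: 'a monoid set"
  shows "rigid_variety V" "l \<in> laws_of V \<longleftrightarrow> satisfies (factor_monoid W) (law_identity l)"
proof -
  note gen = generated_variety_eq[OF inf monoid_factor_monoid finite_factor_monoid[OF W(1)]]
  have "variety V" unfolding V_def gen(1) by simp
  moreover have "identities V = {e. satisfies (factor_monoid W) e}" unfolding V_def by (rule gen(2))
  ultimately show "rigid_variety V" "l \<in> laws_of V \<longleftrightarrow> satisfies (factor_monoid W) (law_identity l)"
    using rigid_theory_factor_monoid[OF W(2)] by (auto intro: rigid_varietyI simp: laws_def)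
qed

lemma law_of_variety_model:
  fixes V :: "'a monoid set"
  assumes inf: "infinite (UNIV :: 'a set)" and W: "finite {w. nonzero W w}"
    and V: "V = var \<Sigma>" "\<And>e. e \<in> \<Sigma> \<Longrightarrow> satisfies (factor_monoid W) e"
    and l: "\<not> satisfies (factor_monoid W) (law_identity l)"
  shows "l \<notin> laws_of V"
  using identities_model[OF inf monoid_factor_monoid finite_factor_monoid[OF W] V] l
  unfolding laws_def by blast

lemma law_all: "(\<forall>l. P l) \<longleftrightarrow> P Trivial \<and> P Idempotent \<and> P Commutative \<and> P Square_Cube \<and>
    P Mid_Left \<and> P Mid_Right \<and> P Left_Right"
  by (metis law.exhaust)

lemma law_set_eq_iff: "A = B \<longleftrightarrow> (\<forall>l :: law. l \<in> A \<longleftrightarrow> l \<in> B)" by blast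

lemma closed_laws_eq:
  assumes c: "closed_laws L"
  shows "Trivial \<in> L \<Longrightarrow>
      L = {Trivial, Idempotent, Commutative, Square_Cube, Mid_Left, Mid_Right, Left_Right}"
    and "Idempotent \<in> L \<Longrightarrow> Trivial \<notin> L \<Longrightarrow> L = {Idempotent, Commutative, Square_Cube, Mid_Left, Mid_Right, Left_Right}"
    and "Commutative \<in> L \<Longrightarrow> Square_Cube \<in> L \<Longrightarrow> Idempotent \<notin> L \<Longrightarrow>
      L = {Commutative, Square_Cube, Mid_Left, Mid_Right, Left_Right}"
    and "Commutative \<in> L \<Longrightarrow> Square_Cube \<notin> L \<Longrightarrow>
      L = {Commutative, Mid_Left, Mid_Right, Left_Right}"
    and "Square_Cube \<in> L \<Longrightarrow> Mid_Left \<in> L \<Longrightarrow> Commutative \<notin> L \<Longrightarrow>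
      L = {Square_Cube, Mid_Left, Mid_Right, Left_Right}"
    and "Square_Cube \<in> L \<Longrightarrow> Mid_Left \<notin> L \<Longrightarrow> L = {Square_Cube, Left_Right}"
    and "Commutative \<notin> L \<Longrightarrow> Square_Cube \<notin> L \<Longrightarrow> Mid_Left \<in> L \<Longrightarrow> Mid_Right \<in> L \<Longrightarrow>
      L = {Mid_Left, Mid_Right, Left_Right}"
    and "Square_Cube \<notin> L \<Longrightarrow> Mid_Left \<in> L \<Longrightarrow> Mid_Right \<notin> L \<Longrightarrow> L = {Mid_Left}"
    and "Square_Cube \<notin> L \<Longrightarrow> Mid_Left \<notin> L \<Longrightarrow> Mid_Right \<in> L \<Longrightarrow> L = {Mid_Right}"
    and "Square_Cube \<notin> L \<Longrightarrow> Mid_Left \<notin> L \<Longrightarrow> Mid_Right \<notin> L \<Longrightarrow> Left_Right \<in> L \<Longrightarrow>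
      L = {Left_Right}"
    and "Square_Cube \<notin> L \<Longrightarrow> Mid_Left \<notin> L \<Longrightarrow> Mid_Right \<notin> L \<Longrightarrow> Left_Right \<notin> L \<Longrightarrow>
      L = {}"
  by (simp only: law_set_eq_iff law_all insert_iff empty_iff UNIV_I Compl_iff law.distinct
      simp_thms; insert c, unfold closed_laws_def, blast)+

text \<open>
  In the order in which the statement of the final theorem lists the corresponding varieties.
\<close>
definition closed_law_sets :: "law set list" where
  "closed_law_sets =
     [{Trivial, Idempotent, Commutative, Square_Cube, Mid_Left, Mid_Right, Left_Right},
      {Idempotent, Commutative, Square_Cube, Mid_Left, Mid_Right, Left_Right},
      {Commutative, Square_Cube, Mid_Left, Mid_Right, Left_Right},
      {Commutative, Mid_Left, Mid_Right, Left_Right},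
      {Square_Cube, Mid_Left, Mid_Right, Left_Right},
      {Square_Cube, Left_Right},
      {Mid_Left, Mid_Right, Left_Right},
      {Left_Right},
      {Mid_Right},
      {Mid_Left},
      {}]"

lemma closed_laws_iff: "closed_laws L \<longleftrightarrow> L \<in> set closed_law_sets"
proof
  show "L \<in> set closed_law_sets" if "closed_laws L"
  proof -
    have "Trivial \<in> L \<or> Trivial \<notin> L" "Idempotent \<in> L \<or> Idempotent \<notin> L"
      "Commutative \<in> L \<or> Commutative \<notin> L" "Square_Cube \<in> L \<or> Square_Cube \<notin> L"
      "Mid_Left \<in> L \<or> Mid_Left \<notin> L" "Mid_Right \<in> L \<or> Mid_Right \<notin> L"
      "Left_Right \<in> L \<or> Left_Right \<notin> L" by blast+
    then show ?thesis
      using closed_laws_eq[OF that] unfolding closed_law_sets_def list.set insert_iff by metis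
  qed
  show "closed_laws L" if "L \<in> set closed_law_sets"
    using that by (auto simp: closed_law_sets_def closed_laws_def)
qed

context
  assumes inf: "infinite (UNIV :: 'a set)"
begin

text \<open>
  For each variety, the few laws decided by a derivation or by a small monoid leave a single closed set.
\<close>
lemma laws_D2:
  "rigid_variety (var_D2 :: 'a monoid set)"
  "laws_of (var_D2 :: 'a monoid set) = {Square_Cube, Left_Right}"
proof -
  note gen = generated_variety_laws[OF inf finite_nonzero(3) rigid_nonzero(3),
      folded D2_monoid_factor_monoid var_D2_def]
  show "rigid_variety (var_D2 :: 'a monoid set)" by (rule gen(1))
  from closed_laws_of[OF this]
  show "laws_of (var_D2 :: 'a monoid set) = {Square_Cube, Left_Right}"
    using gen(2)[of Square_Cube] gen(2)[of Mid_Left] aba_relators_laws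
    unfolding D2_monoid_factor_monoid by (intro closed_laws_eq(6)) blast+
qed

lemma laws_R:
  "rigid_variety (var_R :: 'a monoid set)"
  "laws_of (var_R :: 'a monoid set) = {Mid_Right}"
proof -
  note gen = generated_variety_laws[OF inf finite_nonzero(4) rigid_nonzero(4),
      folded R_monoid_factor_monoid var_R_def]
  show "rigid_variety (var_R :: 'a monoid set)" by (rule gen(1))
  from closed_laws_of[OF this]
  show "laws_of (var_R :: 'a monoid set) = {Mid_Right}"
    using gen(2)[of Square_Cube] gen(2)[of Mid_Left] gen(2)[of Mid_Right] aab_relators_laws
    unfolding R_monoid_factor_monoid by (intro closed_laws_eq(9)) blast+
qed

text \<open>
  Reversing the words in \<open>Mid_Left\<close> gives \<open>Mid_Right\<close>, and rigid identities remain rigid.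
\<close>
lemma laws_R_dual:
  "rigid_variety (dual_variety var_R :: 'a monoid set)"
  "laws_of (dual_variety var_R :: 'a monoid set) = {Mid_Left}"
proof -
  show r: "rigid_variety (dual_variety var_R :: 'a monoid set)"
    by (rule rigid_variety_dual[OF laws_R(1)])
  have "variety (var_R :: 'a monoid set)" using laws_R(1) by (simp add: rigid_variety_def)
  note dual = identities_dual[OF this]
  have mem: "l \<in> laws_of (var_R :: 'a monoid set) \<longleftrightarrow> l = Mid_Right" for l using laws_R(2) by simp
  have "Mid_Left \<in> laws_of (dual_variety var_R :: 'a monoid set)"
    "Mid_Right \<notin> laws_of (dual_variety var_R :: 'a monoid set)"
    "Square_Cube \<notin> laws_of (dual_variety var_R :: 'a monoid set)"
    using mem[of Mid_Right] mem[of Mid_Left] mem[of Square_Cube] by (simp_all add: laws_def dual)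
  with closed_laws_of[OF r] show "laws_of (dual_variety var_R :: 'a monoid set) = {Mid_Left}"
    by (intro closed_laws_eq(8))
qed

lemma laws_D:
  "rigid_variety (var_D :: 'a monoid set)"
  "laws_of (var_D :: 'a monoid set) = {Square_Cube, Mid_Left, Mid_Right, Left_Right}"
proof -
  have v: "variety (var_D :: 'a monoid set)" by (simp add: var_D_def)
  interpret equational_theory "identities (var_D :: 'a monoid set)"
    by (rule equational_theory_identities[OF v])
  have ax: "([0, 0], [0, 0, 0]) \<in> identities (var_D :: 'a monoid set)"
      "([0, 0, 1], [0, 1, 0]) \<in> identities (var_D :: 'a monoid set)"
      "([0, 1, 0], [1, 0, 0]) \<in> identities (var_D :: 'a monoid set)"
    unfolding var_D_def by (rule subsetD[OF subset_identities_var], simp)+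
  have laws: "Square_Cube \<in> laws_of (var_D :: 'a monoid set)" "Mid_Left \<in> laws_of (var_D :: 'a monoid set)"
    "Mid_Right \<in> laws_of (var_D :: 'a monoid set)" "Left_Right \<in> laws_of (var_D :: 'a monoid set)"
    using ax sym[OF ax(2)] trans[OF ax(2,3)] by (simp_all add: laws_def)
  show r: "rigid_variety (var_D :: 'a monoid set)"
    using v rigid_theory_if_square_cube_mid[OF laws(1,2,4)] by (rule rigid_varietyI)
  interpret ab: equational_theory "{e. satisfies (factor_monoid ab_relators) e}"
    by (rule monoid.equational_theory_satisfied[OF monoid_factor_monoid])
  have "satisfies (factor_monoid ab_relators) e"
    if "e \<in> {([0, 0], [0, 0, 0]), ([0, 0, 1], [0, 1, 0]), ([0, 1, 0], [1, 0, 0])}" for e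
    using that ab_relators_laws ab.sym[of "[0, 1, 0]" "[0, 0, 1]"] by auto
  then have "Commutative \<notin> laws_of (var_D :: 'a monoid set)"
    by (rule law_of_variety_model[OF inf finite_nonzero(2) var_D_def _ ab_relators_laws(1)])
  with laws closed_laws_of[OF r]
  show "laws_of (var_D :: 'a monoid set) = {Square_Cube, Mid_Left, Mid_Right, Left_Right}"
    by (intro closed_laws_eq(5))
qed

lemma laws_C_cases:
  fixes n :: nat
  assumes n: "n = 2 \<or> n = 3"
  shows "rigid_variety (var_C n :: 'a monoid set)"
    "laws_of (var_C n :: 'a monoid set) =
      (if n = 2 then {Square_Cube} else {}) \<union> {Commutative, Mid_Left, Mid_Right, Left_Right}"
proof -
  let ?V = "var_C n :: 'a monoid set"
  have v: "variety ?V" by (simp add: var_C_def)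
  interpret equational_theory "identities ?V" by (rule equational_theory_identities[OF v])
  have ax: "(replicate n 0, replicate (n + 1) 0) \<in> identities ?V" "([0, 1], [1, 0]) \<in> identities ?V"
    unfolding var_C_def by (rule subsetD[OF subset_identities_var], simp)+
  then have comm: "Commutative \<in> laws_of ?V" by (simp add: laws_def)
  have "(replicate 3 0, replicate 4 0) \<in> identities ?V"
    using n
  proof
    assume "n = 2"
    then have "([0] @ replicate 2 0, [0] @ replicate 3 0) \<in> identities ?V" using ax(1) by (intro mult refl) simp
    then show ?thesis by (simp add: numeral_eq_Suc)
  qed (use ax(1) in simp)
  then show r: "rigid_variety ?V"
    by (intro rigid_varietyI v rigid_theory_if_commutative comm)
  have sat: "satisfies (factor_monoid (power_relator n)) e"
    if "e \<in> {(replicate n 0, replicate (n + 1) 0), ([0, 1], [1, 0])}" for e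
  proof -
    have "satisfies (factor_monoid (power_relator n)) (replicate n 0, replicate (n + 1) 0)"
    proof -
      \<comment> \<open>If the value of the letter is not empty, both powers have at least \<open>n\<close> letters and are zero.\<close>
      have letters: "set (replicate n (0 :: nat)) = set (replicate (n + 1) 0)" using n by auto
      have "concat (map g (replicate n 0)) = concat (map g (replicate (n + 1) 0)) \<or>
          \<not> nonzero (power_relator n) (concat (map g (replicate n 0))) \<and>
          \<not> nonzero (power_relator n) (concat (map g (replicate (n + 1) 0)))" for g :: "nat \<Rightarrow> unit list"
      proof (cases "g 0 = []")
        case False
        then have "m \<le> length (concat (map g (replicate m 0)))" for m
          by (cases "g 0") (simp_all add: length_concat sum_list_replicate)
        from this[of n] this[of "n + 1"] show ?thesis by (simp add: nonzero_power_relator)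
      qed simp
      then show ?thesis unfolding satisfies_factor_monoid_iff[OF letters] by blast
    qed
    with that power_relator_laws(3)[of n] show ?thesis by auto
  qed
  have not: "l \<notin> laws_of ?V" if "\<not> satisfies (factor_monoid (power_relator n)) (law_identity l)" for l
    by (rule law_of_variety_model[OF inf finite_nonzero(1) var_C_def sat that])
  show "laws_of ?V =
      (if n = 2 then {Square_Cube} else {}) \<union> {Commutative, Mid_Left, Mid_Right, Left_Right}"
    using n
  proof
    assume n: "n = 2"
    then have "Square_Cube \<in> laws_of ?V" using ax(1) by (simp add: laws_def numeral_eq_Suc)
    moreover have "Idempotent \<notin> laws_of ?V" using not power_relator_laws(1) n by simp
    ultimately show ?thesis using closed_laws_eq(3)[OF closed_laws_of[OF r] comm] n by auto
  next
    assume n: "n = 3"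
    then have "Square_Cube \<notin> laws_of ?V" using not power_relator_laws(2) by simp
    then show ?thesis using closed_laws_eq(4)[OF closed_laws_of[OF r] comm] n by auto
  qed
qed

lemma laws_C2:
  "rigid_variety (var_C 2 :: 'a monoid set)"
  "laws_of (var_C 2 :: 'a monoid set) = {Commutative, Square_Cube, Mid_Left, Mid_Right, Left_Right}"
  using laws_C_cases[of 2] by auto

lemma laws_C3:
  "rigid_variety (var_C 3 :: 'a monoid set)"
  "laws_of (var_C 3 :: 'a monoid set) = {Commutative, Mid_Left, Mid_Right, Left_Right}"
  using laws_C_cases[of 3] by auto

lemma laws_SL:
  "rigid_variety (var_SL :: 'a monoid set)"
  "laws_of (var_SL :: 'a monoid set) = {Idempotent, Commutative, Square_Cube, Mid_Left, Mid_Right, Left_Right}"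
proof -
  let ?V = "var_SL :: 'a monoid set"
  have eq: "?V = var {law_identity Idempotent, law_identity Commutative}"
  proof (intro Set.set_eqI iffI)
    fix M :: "'a monoid" assume "M \<in> ?V"
    then have M: "comm_monoid M" "\<forall>x\<in>carrier M. x \<otimes>\<^bsub>M\<^esub> x = x" by (auto simp: var_SL_def)
    interpret comm_monoid M by (rule M(1))
    show "M \<in> var {law_identity Idempotent, law_identity Commutative}"
      using M(2) monoid_axioms by (simp add: var_def satisfies_def m_comm)
  next
    fix M :: "'a monoid" assume "M \<in> var {law_identity Idempotent, law_identity Commutative}"
    then have M: "monoid M" and idem: "satisfies M ([0], [0, 0])" and comm: "satisfies M ([0, 1], [1, 0])"
      by (auto simp: var_def)
    interpret monoid M by (rule M)
    have "x \<otimes>\<^bsub>M\<^esub> x = x" if "x \<in> carrier M" for x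
      using idem[unfolded satisfies_def, rule_format, of "\<lambda>_. x"] that by simp
    moreover have "x \<otimes>\<^bsub>M\<^esub> y = y \<otimes>\<^bsub>M\<^esub> x" if "x \<in> carrier M" "y \<in> carrier M" for x y
      using comm[unfolded satisfies_def, rule_format, of "\<lambda>i. if i = 0 then x else y"] that by simp
    ultimately show "M \<in> ?V" using M by (auto simp: var_SL_def intro: monoid_comm_monoidI)
  qed
  have v: "variety ?V" unfolding eq by simp
  interpret equational_theory "identities ?V" by (rule equational_theory_identities[OF v])
  have laws: "Idempotent \<in> laws_of ?V" "Commutative \<in> laws_of ?V"
    unfolding eq laws_def mem_Collect_eq by (rule subsetD[OF subset_identities_var], simp)+
  have "([0, 0, 0], [0, 0, 0] @ [0]) \<in> identities ?V"
    using mult[OF refl[of "[0, 0]"] law_instances(2)[OF laws(1), of "[0]"]] by simp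
  then have "(replicate 3 0, replicate 4 0) \<in> identities ?V" by (simp add: numeral_eq_Suc)
  then show r: "rigid_variety ?V"
    by (intro rigid_varietyI v rigid_theory_if_commutative laws)
  have "Trivial \<notin> laws_of ?V"
  proof (rule law_of_variety_model[OF inf finite_nonzero(1) eq _ not_satisfies_trivial])
    fix e assume "e \<in> {law_identity Idempotent, law_identity Commutative}"
    then show "satisfies (factor_monoid (power_relator 1)) e"
      using power_relator_1_idempotent power_relator_laws(3) by blast
  qed
  then show "laws_of ?V = {Idempotent, Commutative, Square_Cube, Mid_Left, Mid_Right, Left_Right}" by (rule closed_laws_eq(2)[OF closed_laws_of[OF r] laws(1)])
qed

lemma laws_T:
  "rigid_variety (var_T :: 'a monoid set)"
  "laws_of (var_T :: 'a monoid set) =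
    {Trivial, Idempotent, Commutative, Square_Cube, Mid_Left, Mid_Right, Left_Right}"
proof -
  let ?V = "var_T :: 'a monoid set"
  have all: "satisfies M e" if "M \<in> ?V" for M and e
  proof -
    have M: "monoid M" "carrier M = {\<one>\<^bsub>M\<^esub>}" using that by (simp_all add: var_T_def)
    have "word_value M \<phi> w = \<one>\<^bsub>M\<^esub>" if "\<forall>i. \<phi> i \<in> carrier M" for \<phi> w
      using monoid.word_value_closed[OF M(1), of \<phi> w] that M(2) by auto
    then show ?thesis by (simp add: satisfies_def)
  qed
  then have ids: "identities ?V = UNIV" by (auto simp: identities_def)
  have "?V = var {law_identity Trivial}"
  proof (intro Set.set_eqI iffI)
    fix M :: "'a monoid" assume "M \<in> var {law_identity Trivial}"
    then have M: "monoid M" and triv: "satisfies M ([0], [])" by (auto simp: var_def)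
    interpret monoid M by (rule M)
    have "x = \<one>\<^bsub>M\<^esub>" if "x \<in> carrier M" for x
      using triv[unfolded satisfies_def, rule_format, of "\<lambda>_. x"] that by simp
    then show "M \<in> ?V" using M by (auto simp: var_T_def)
  qed (use all in \<open>auto simp: var_def var_T_def\<close>)
  then have "variety ?V" by (metis variety_var)
  then show "rigid_variety ?V" by (simp add: rigid_variety_def ids)
  then show "laws_of ?V = {Trivial, Idempotent, Commutative, Square_Cube, Mid_Left, Mid_Right, Left_Right}"
    by (intro closed_laws_eq(1) closed_laws_of) (simp_all add: laws_def ids)
qed

end

section \<open>The subvariety lattice\<close>

lemma variety_lattice:
  fixes V :: "'a monoid set"
  assumes "variety V"
  shows "lattice (subvariety_lattice V)"
    and "\<lbrakk>A \<in> carrier (subvariety_lattice V); B \<in> carrier (subvariety_lattice V)\<rbrakk> \<Longrightarrow>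
      A \<squnion>\<^bsub>subvariety_lattice V\<^esub> B = A \<or>\<^sub>v B"
    and "\<lbrakk>A \<in> carrier (subvariety_lattice V); B \<in> carrier (subvariety_lattice V)\<rbrakk> \<Longrightarrow>
      A \<sqinter>\<^bsub>subvariety_lattice V\<^esub> B = A \<inter> B"
proof -
  let ?L = "subvariety_lattice V"
  have carr: "W \<in> carrier ?L \<longleftrightarrow> variety W \<and> W \<subseteq> V" for W by (simp add: subvariety_lattice_def)
  have le: "W \<sqsubseteq>\<^bsub>?L\<^esub> W' \<longleftrightarrow> W \<subseteq> W'" for W W' by (simp add: subvariety_lattice_def)
  interpret partial_order ?L
    by unfold_locales (auto simp: subvariety_lattice_def)
  have sup: "least ?L (A \<or>\<^sub>v B) (Upper ?L {A, B})" if "A \<in> carrier ?L" "B \<in> carrier ?L" for A B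
    using that variety_join[of A B] assms
    by (intro least_UpperI) (auto simp: carr le Upper_def)
  have inf: "greatest ?L (A \<inter> B) (Lower ?L {A, B})" if "A \<in> carrier ?L" "B \<in> carrier ?L" for A B
    using that variety_Int[of A B]
    by (intro greatest_LowerI) (auto simp: carr le Lower_def)
  show lat: "lattice ?L"
    by unfold_locales (use sup inf in blast)+
  show "A \<squnion>\<^bsub>?L\<^esub> B = A \<or>\<^sub>v B" if "A \<in> carrier ?L" "B \<in> carrier ?L"
    unfolding join_def sup_def
    by (rule some_equality) (use sup[OF that] least_unique in blast)+
  show "A \<sqinter>\<^bsub>?L\<^esub> B = A \<inter> B" if "A \<in> carrier ?L" "B \<in> carrier ?L"
    unfolding meet_def inf_def
    by (rule some_equality) (use inf[OF that] greatest_unique in blast)+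
qed

text \<open>
  Pairs of positions in the list of closed sets of laws, lower variety first; the larger set of laws
  belongs to the smaller variety.
\<close>
definition hasse_edges :: "(nat \<times> nat) list" where
  "hasse_edges =
     [(0, 1), (1, 2), (2, 4), (2, 3), (4, 5), (4, 6), (3, 6), (5, 7), (6, 7), (6, 8), (6, 9),
      (7, 10), (8, 10), (9, 10)]"

definition law_set_covers :: "(law set \<times> law set) list" where
  "law_set_covers = map (\<lambda>(i, j). (closed_law_sets ! i, closed_law_sets ! j))
     hasse_edges"

lemma law_set_covers:
  "\<forall>P \<in> set closed_law_sets. \<forall>Q \<in> set closed_law_sets.
     (Q \<subset> P \<and> \<not> (\<exists>C \<in> set closed_law_sets. Q \<subset> C \<and> C \<subset> P)) = ((P, Q) \<in> set law_set_covers)"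
  by code_simp

lemma distinct_closed_law_sets: "distinct closed_law_sets"
  by code_simp

lemma closed_laws_Int: "closed_laws X \<Longrightarrow> closed_laws Y \<Longrightarrow> closed_laws (X \<inter> Y)"
  unfolding closed_laws_def by blast

text \<open>
  The nontrivial half of the modular law, with \<open>M\<close> contained in the closure of \<open>Y \<union> Z\<close>. The closure
  exceeds the union only if \<open>Y\<close> and \<open>Z\<close> contribute different laws \<open>i\<close> and \<open>j\<close> among the last three, and
  then it adds the third one, \<open>k\<close>. If \<open>k \<in> X\<close>, then \<open>j \<in> Z \<subseteq> X\<close> forces \<open>i \<in> X\<close>, so \<open>i\<close> and \<open>j\<close> are both in
  \<open>N\<close>, and hence \<open>k\<close> is.
\<close>
lemma closed_laws_modular:
  assumes X: "closed_laws X" and Y: "closed_laws Y" and Z: "closed_laws Z" and "Z \<subseteq> X"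
    and M: "\<And>C. closed_laws C \<Longrightarrow> Y \<union> Z \<subseteq> C \<Longrightarrow> M \<subseteq> C"
    and N: "closed_laws N" "X \<inter> Y \<union> Z \<subseteq> N"
  shows "X \<inter> M \<subseteq> N"
proof (cases "closed_laws (Y \<union> Z)")
  case True
  then show ?thesis using M[OF True] N by blast
next
  case False
  let ?mid = "{Mid_Left, Mid_Right, Left_Right}"
  have "closed_laws (Y \<union> Z \<union> ?mid)"
    using Y Z unfolding closed_laws_def by blast
  then have "M \<subseteq> Y \<union> Z \<union> ?mid" by (rule M) blast
  moreover have "\<exists>i\<in>?mid. \<exists>j\<in>?mid. i \<noteq> j \<and> i \<in> Y \<and> j \<in> Z"
    using False Y Z unfolding closed_laws_def by blast
  moreover have two: "k \<in> A" if "closed_laws A" "i \<in> A" "j \<in> A" "i \<noteq> j" "i \<in> ?mid" "j \<in> ?mid" "k \<in> ?mid"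
    for A i j k
    using that unfolding closed_laws_def by blast
  ultimately obtain i j where M': "M \<subseteq> Y \<union> Z \<union> ?mid"
    and ij: "i \<in> ?mid" "j \<in> ?mid" "i \<noteq> j" "i \<in> Y" "j \<in> Z" by blast
  show ?thesis
  proof
    fix k assume k: "k \<in> X \<inter> M"
    show "k \<in> N"
    proof (cases "k \<in> Y \<union> Z")
      case True
      then show ?thesis using k N by blast
    next
      case False
      then have kmid: "k \<in> ?mid" "k \<noteq> j" using k M' ij by auto
      have "j \<in> X" using ij \<open>Z \<subseteq> X\<close> by blast
      then have "i \<in> X" using two[OF X, of k j i] k kmid ij by blast
      then have "i \<in> N" "j \<in> N" using N ij by blast+
      then show ?thesis using two[OF N(1), of i j k] kmid ij by blast
    qed
  qed
qed

context
  assumes inf: "infinite (UNIV :: 'a set)"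
begin

abbreviation subvarieties :: "'a monoid set list" where
  "subvarieties \<equiv> [var_T, var_SL, var_C 2, var_C 3, var_D, var_D2, var_D \<or>\<^sub>v var_C 3,
     var_D2 \<or>\<^sub>v var_C 3, var_R, dual_variety var_R, var_R \<or>\<^sub>v dual_variety var_R]"

lemma subvarieties_laws:
  "\<forall>V \<in> set subvarieties. rigid_variety V"
  "map laws_of subvarieties = closed_law_sets"
proof -
  note rigid = laws_T(1)[OF inf] laws_SL(1)[OF inf] laws_C2(1)[OF inf] laws_C3(1)[OF inf]
    laws_D(1)[OF inf] laws_D2(1)[OF inf] laws_R(1)[OF inf] laws_R_dual(1)[OF inf]
  note laws = laws_T(2)[OF inf] laws_SL(2)[OF inf] laws_C2(2)[OF inf] laws_C3(2)[OF inf]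
    laws_D(2)[OF inf] laws_D2(2)[OF inf] laws_R(2)[OF inf] laws_R_dual(2)[OF inf]
  show "\<forall>V \<in> set subvarieties. rigid_variety V"
    using rigid by (auto intro: rigid_variety_join)
  show "map laws_of subvarieties = closed_law_sets"
    using rigid by (simp add: closed_law_sets_def laws rigid_variety_join)
qed

abbreviation top_variety :: "'a monoid set" where
  "top_variety \<equiv> var_R \<or>\<^sub>v dual_variety var_R"

abbreviation L :: "'a monoid set gorder" where
  "L \<equiv> subvariety_lattice top_variety"

lemma rigid_top: "rigid_variety top_variety" using subvarieties_laws(1) by simp

lemma laws_top: "laws_of top_variety = {}"
  using rigid_variety_join(2)[OF laws_R(1)[OF inf] laws_R_dual(1)[OF inf]]
  by (simp add: laws_R(2)[OF inf] laws_R_dual(2)[OF inf])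

lemma carrier_L: "carrier L = {V. rigid_variety V}"
  using rigid_variety_subset[OF rigid_top] rigid_variety_subset_iff[OF _ rigid_top] laws_top
  by (auto simp: subvariety_lattice_def rigid_variety_def)

lemma rigid_variety_eqI: "rigid_variety V \<Longrightarrow> rigid_variety W \<Longrightarrow> laws_of V = laws_of W \<Longrightarrow> V = W"
  for V W :: "'a monoid set"
  using rigid_variety_subset_iff[of V W] rigid_variety_subset_iff[of W V] by blast

lemma variety_with_laws:
  assumes "closed_laws C"
  obtains V :: "'a monoid set" where "V \<in> set subvarieties" "laws_of V = C"
proof -
  have "C \<in> set (map laws_of subvarieties)"
    using assms unfolding subvarieties_laws(2) closed_laws_iff .
  then show thesis using that by (auto simp only: set_map)
qed

lemma carrier_L_eq: "carrier L = set subvarieties"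
proof
  show "set subvarieties \<subseteq> carrier L" using subvarieties_laws(1) unfolding carrier_L by blast
  show "carrier L \<subseteq> set subvarieties"
  proof
    fix V assume "V \<in> carrier L"
    then have V: "rigid_variety V" unfolding carrier_L by simp
    then obtain W where W: "W \<in> set subvarieties" "laws_of W = laws_of V"
      using variety_with_laws[OF closed_laws_of] by metis
    then have "V = W" using V subvarieties_laws(1) by (intro rigid_variety_eqI) auto
    then show "V \<in> set subvarieties" using W by simp
  qed
qed

lemma distinct_subvarieties: "distinct subvarieties"
proof -
  have "distinct (map laws_of subvarieties)"
    unfolding subvarieties_laws(2) by (rule distinct_closed_law_sets)
  then show ?thesis unfolding distinct_map by blast
qed

lemma lless_L: "A \<in> carrier L \<Longrightarrow> B \<in> carrier L \<Longrightarrow> A \<sqsubset>\<^bsub>L\<^esub> B \<longleftrightarrow> laws_of B \<subset> laws_of A"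
proof -
  assume "A \<in> carrier L" "B \<in> carrier L"
  then have r: "rigid_variety A" "rigid_variety B" unfolding carrier_L by simp_all
  have "A \<sqsubset>\<^bsub>L\<^esub> B \<longleftrightarrow> A \<subset> B"
    by (auto simp: lless_def subvariety_lattice_def)
  also have "\<dots> \<longleftrightarrow> laws_of B \<subset> laws_of A"
    using rigid_variety_subset_iff[OF r] rigid_variety_subset_iff[OF r(2,1)] by blast
  finally show ?thesis .
qed

lemma covering_relation_L:
  "covering_relation L = {(A, B). A \<in> carrier L \<and> B \<in> carrier L \<and> (laws_of A, laws_of B) \<in> set law_set_covers}"
proof -
  have carr: "laws_of V \<in> set closed_law_sets" if "V \<in> carrier L" for V
    using that closed_laws_of unfolding carrier_L closed_laws_iff by blast
  have between: "(\<exists>C\<in>carrier L. A \<sqsubset>\<^bsub>L\<^esub> C \<and> C \<sqsubset>\<^bsub>L\<^esub> B) \<longleftrightarrow>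
      (\<exists>C\<in>set closed_law_sets. laws_of B \<subset> C \<and> C \<subset> laws_of A)"
    if "A \<in> carrier L" "B \<in> carrier L" for A B
  proof
    assume "\<exists>C\<in>carrier L. A \<sqsubset>\<^bsub>L\<^esub> C \<and> C \<sqsubset>\<^bsub>L\<^esub> B"
    then obtain C where C: "C \<in> carrier L" "A \<sqsubset>\<^bsub>L\<^esub> C" "C \<sqsubset>\<^bsub>L\<^esub> B" by blast
    then have "laws_of B \<subset> laws_of C" "laws_of C \<subset> laws_of A"
      using lless_L[OF that(1) C(1)] lless_L[OF C(1) that(2)] by simp_all
    then show "\<exists>C\<in>set closed_law_sets. laws_of B \<subset> C \<and> C \<subset> laws_of A"
      using carr[OF C(1)] by (intro bexI[of _ "laws_of C"] conjI)
  next
    assume "\<exists>C\<in>set closed_law_sets. laws_of B \<subset> C \<and> C \<subset> laws_of A"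
    then obtain C where C: "closed_laws C" "laws_of B \<subset> C" "C \<subset> laws_of A"
      unfolding closed_laws_iff by blast
    obtain V where V: "V \<in> carrier L" "laws_of V = C"
      using variety_with_laws[OF C(1)] unfolding carrier_L_eq by blast
    then have "A \<sqsubset>\<^bsub>L\<^esub> V" "V \<sqsubset>\<^bsub>L\<^esub> B"
      using lless_L[OF that(1) V(1)] lless_L[OF V(1) that(2)] C by simp_all
    then show "\<exists>C\<in>carrier L. A \<sqsubset>\<^bsub>L\<^esub> C \<and> C \<sqsubset>\<^bsub>L\<^esub> B"
      using V(1) by (intro bexI[of _ V] conjI)
  qed
  have "A \<sqsubset>\<^bsub>L\<^esub> B \<and> \<not> (\<exists>C\<in>carrier L. A \<sqsubset>\<^bsub>L\<^esub> C \<and> C \<sqsubset>\<^bsub>L\<^esub> B) \<longleftrightarrow>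
      (laws_of A, laws_of B) \<in> set law_set_covers" if "A \<in> carrier L" "B \<in> carrier L" for A B
    using law_set_covers[rule_format, OF carr[OF that(1)] carr[OF that(2)]]
    unfolding between[OF that] lless_L[OF that] .
  then show ?thesis unfolding covering_relation_def by blast
qed

lemma covering_pairs:
  "covering_relation L = set (map (\<lambda>(i, j). (subvarieties ! i, subvarieties ! j))
     hasse_edges)" (is "_ = set (map ?f hasse_edges)")
proof -
  have nth: "laws_of (subvarieties ! i) = closed_law_sets ! i" if "i < 11" for i
    using that nth_map[of i subvarieties laws_of] unfolding subvarieties_laws(2) by simp
  have mem: "subvarieties ! i \<in> carrier L" if "i < 11" for i
    unfolding carrier_L_eq using that by (intro nth_mem) simp
  have small: "i < 11 \<and> j < 11" if "(i, j) \<in> set hasse_edges" for i j using that by (auto simp: hasse_edges_def)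
  have unique: "A = subvarieties ! i" if "A \<in> carrier L" "laws_of A = closed_law_sets ! i" "i < 11" for A i
    using that nth[OF that(3)] mem[OF that(3)] unfolding carrier_L by (intro rigid_variety_eqI) auto
  show ?thesis
  proof (intro Set.set_eqI iffI)
    fix e assume "e \<in> covering_relation L"
    then obtain A B where e: "e = (A, B)" "A \<in> carrier L" "B \<in> carrier L"
        "(laws_of A, laws_of B) \<in> set law_set_covers"
      unfolding covering_relation_L by blast
    then obtain i j where ij: "(i, j) \<in> set hasse_edges"
        "laws_of A = closed_law_sets ! i" "laws_of B = closed_law_sets ! j"
      unfolding law_set_covers_def by auto
    have "A = subvarieties ! i" "B = subvarieties ! j"
      using unique e(2,3) ij small[OF ij(1)] by blast+
    then have "e = ?f (i, j)" by (simp only: e(1) prod.case)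
    then show "e \<in> set (map ?f hasse_edges)" unfolding set_map using ij(1) by (rule image_eqI)
  next
    fix e assume "e \<in> set (map ?f hasse_edges)"
    then obtain i j where ij: "(i, j) \<in> set hasse_edges" and e: "e = (subvarieties ! i, subvarieties ! j)"
      by auto
    have "(closed_law_sets ! i, closed_law_sets ! j) \<in> set law_set_covers"
      unfolding law_set_covers_def set_map using ij by (intro image_eqI[of _ _ "(i, j)"]) auto
    then show "e \<in> covering_relation L"
      unfolding covering_relation_L e using small[OF ij] mem nth by simp
  qed
qed

text \<open>
  The laws of a meet are the closure of the union: every closed set is the set of laws of some variety,
  and the one belonging to a closed set \<open>C\<close> above both sets lies below both varieties.
\<close>
lemma laws_Int_least:
  fixes A B :: "'a monoid set"
  assumes "rigid_variety A" "rigid_variety B"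
  shows "rigid_variety (A \<inter> B)" "laws_of A \<union> laws_of B \<subseteq> laws_of (A \<inter> B)"
    "closed_laws C \<Longrightarrow> laws_of A \<union> laws_of B \<subseteq> C \<Longrightarrow> laws_of (A \<inter> B) \<subseteq> C"
proof -
  have "variety (A \<inter> B)" using assms variety_Int[of A B] by (simp add: rigid_variety_def)
  then show r: "rigid_variety (A \<inter> B)" by (rule rigid_variety_subset[OF assms(1)]) simp
  show "laws_of A \<union> laws_of B \<subseteq> laws_of (A \<inter> B)"
    using rigid_variety_subset_iff[OF r assms(1)] rigid_variety_subset_iff[OF r assms(2)] by blast
  assume C: "closed_laws C" "laws_of A \<union> laws_of B \<subseteq> C"
  then obtain V where V: "V \<in> set subvarieties" "laws_of V = C" using variety_with_laws by metis
  then have rV: "rigid_variety V" using subvarieties_laws(1) by blast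
  have "V \<subseteq> A \<inter> B"
    using rigid_variety_subset_iff[OF rV assms(1)] rigid_variety_subset_iff[OF rV assms(2)] V C by blast
  then show "laws_of (A \<inter> B) \<subseteq> C" using rigid_variety_subset_iff[OF rV r] V by blast
qed

lemma modular_L: "modular_lattice L"
proof -
  have top: "variety top_variety" using rigid_top by (simp add: rigid_variety_def)
  note lat = variety_lattice[OF top]
  have "A \<squnion>\<^bsub>L\<^esub> (B \<sqinter>\<^bsub>L\<^esub> C) = (A \<squnion>\<^bsub>L\<^esub> B) \<sqinter>\<^bsub>L\<^esub> C"
    if ABC: "A \<in> carrier L" "B \<in> carrier L" "C \<in> carrier L" "A \<sqsubseteq>\<^bsub>L\<^esub> C" for A B C
  proof -
    have r: "rigid_variety A" "rigid_variety B" "rigid_variety C" using ABC unfolding carrier_L by simp_all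
    have "A \<subseteq> C" using ABC(4) by (simp add: subvariety_lattice_def)
    then have le: "laws_of C \<subseteq> laws_of A" using rigid_variety_subset_iff r by blast
    note BC = laws_Int_least[OF r(2,3)]
    note AB = rigid_variety_join[OF r(1,2)]
    note ABC' = laws_Int_least[OF AB(1) r(3)]
    note ABC'' = rigid_variety_join[OF r(1) BC(1)]
    have "A \<or>\<^sub>v (B \<inter> C) = (A \<or>\<^sub>v B) \<inter> C"
    proof (rule rigid_variety_eqI[OF ABC''(1) ABC'(1)], rule equalityI)
      show "laws_of (A \<or>\<^sub>v (B \<inter> C)) \<subseteq> laws_of ((A \<or>\<^sub>v B) \<inter> C)"
        unfolding ABC''(2)
        by (rule closed_laws_modular[OF r[THEN closed_laws_of] le BC(3) closed_laws_of[OF ABC'(1)]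
              ABC'(2)[unfolded AB(2)]])
      show "laws_of ((A \<or>\<^sub>v B) \<inter> C) \<subseteq> laws_of (A \<or>\<^sub>v (B \<inter> C))"
        unfolding ABC''(2)
        by (rule ABC'(3)) (use closed_laws_Int closed_laws_of r BC AB(2) le in blast)+
    qed
    moreover have "B \<inter> C \<in> carrier L" "A \<or>\<^sub>v B \<in> carrier L" using BC(1) AB(1) unfolding carrier_L by simp_all
    ultimately show ?thesis using ABC by (simp add: lat)
  qed
  then show ?thesis using lat(1) unfolding modular_lattice_def by blast
qed

text \<open>
  \<open>\<^bold>R\<close>, \<open>\<^bold>R\<^sup>\<delta>\<close> and \<open>\<^bold>D\<^sub>2 \<or> \<^bold>C\<^sub>3\<close> are the three atoms of the interval that is a partition lattice: any two of
  them have the join \<open>\<^bold>R \<or> \<^bold>R\<^sup>\<delta>\<close> and the meet \<open>\<^bold>D \<or> \<^bold>C\<^sub>3\<close>.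
\<close>
lemma not_distributive_L: "\<not> distributive_lattice L"
proof
  assume d: "distributive_lattice L"
  have top: "variety top_variety" using rigid_top by (simp add: rigid_variety_def)
  note lat = variety_lattice[OF top]
  define A B C :: "'a monoid set" where "A = var_R" and "B = dual_variety var_R" and "C = var_D2 \<or>\<^sub>v var_C 3"
  have r: "rigid_variety A" "rigid_variety B" "rigid_variety C"
    using subvarieties_laws(1) by (simp_all add: A_def B_def C_def)
  have laws: "laws_of A = {Mid_Right}" "laws_of B = {Mid_Left}" "laws_of C = {Left_Right}"
    using laws_R(2)[OF inf] laws_R_dual(2)[OF inf] subvarieties_laws(2)
    by (simp_all add: A_def B_def C_def closed_law_sets_def)
  note BC = rigid_variety_join[OF r(2,3)]
  note AB = laws_Int_least[OF r(1,2)] and AC = laws_Int_least[OF r(1,3)]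
  have mem: "A \<in> carrier L" "B \<in> carrier L" "C \<in> carrier L" "B \<or>\<^sub>v C \<in> carrier L"
    "A \<inter> B \<in> carrier L" "A \<inter> C \<in> carrier L"
    using r BC(1) AB(1) AC(1) unfolding carrier_L by simp_all
  have "A \<sqinter>\<^bsub>L\<^esub> (B \<squnion>\<^bsub>L\<^esub> C) = (A \<sqinter>\<^bsub>L\<^esub> B) \<squnion>\<^bsub>L\<^esub> (A \<sqinter>\<^bsub>L\<^esub> C)"
    using d mem unfolding distributive_lattice_def by blast
  then have eq: "A \<inter> (B \<or>\<^sub>v C) = (A \<inter> B) \<or>\<^sub>v (A \<inter> C)" using mem by (simp add: lat)
  have "laws_of (A \<inter> (B \<or>\<^sub>v C)) \<subseteq> {Mid_Right}"
    by (rule laws_Int_least(3)[OF r(1) BC(1)]) (auto simp: BC(2) laws closed_laws_def)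
  moreover have "Mid_Left \<in> laws_of ((A \<inter> B) \<or>\<^sub>v (A \<inter> C))"
  proof -
    have "Mid_Left \<in> laws_of (A \<inter> C)"
      using closed_laws_of[OF AC(1)] AC(2) laws unfolding closed_laws_def by blast
    then show ?thesis using AB(2) laws unfolding rigid_variety_join(2)[OF AB(1) AC(1)] by blast
  qed
  ultimately show False unfolding eq by blast
qed

end

theorem proposition3p1:
  assumes "infinite (UNIV :: 'a set)"
  shows
    "carrier (subvariety_lattice (var_R \<or>\<^sub>v dual_variety var_R)) =
       ({var_T, var_SL, var_C 2, var_C 3, var_D, var_D2, var_D \<or>\<^sub>v var_C 3, var_D2 \<or>\<^sub>v var_C 3,
         var_R, dual_variety var_R, var_R \<or>\<^sub>v dual_variety var_R} :: 'a monoid set set) \<and>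
     distinct
       ([var_T, var_SL, var_C 2, var_C 3, var_D, var_D2, var_D \<or>\<^sub>v var_C 3, var_D2 \<or>\<^sub>v var_C 3,
         var_R, dual_variety var_R, var_R \<or>\<^sub>v dual_variety var_R] :: 'a monoid set list) \<and>
     covering_relation (subvariety_lattice (var_R \<or>\<^sub>v dual_variety var_R)) =
       ({(var_T, var_SL), (var_SL, var_C 2), (var_C 2, var_D), (var_C 2, var_C 3),
         (var_D, var_D2), (var_D, var_D \<or>\<^sub>v var_C 3), (var_C 3, var_D \<or>\<^sub>v var_C 3),
         (var_D2, var_D2 \<or>\<^sub>v var_C 3), (var_D \<or>\<^sub>v var_C 3, var_D2 \<or>\<^sub>v var_C 3),
         (var_D \<or>\<^sub>v var_C 3, var_R), (var_D \<or>\<^sub>v var_C 3, dual_variety var_R),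
         (var_D2 \<or>\<^sub>v var_C 3, var_R \<or>\<^sub>v dual_variety var_R),
         (var_R, var_R \<or>\<^sub>v dual_variety var_R),
         (dual_variety var_R, var_R \<or>\<^sub>v dual_variety var_R)} :: 'a monoid set rel) \<and>
     lattice (subvariety_lattice (var_R \<or>\<^sub>v dual_variety var_R :: 'a monoid set)) \<and>
     modular_lattice (subvariety_lattice (var_R \<or>\<^sub>v dual_variety var_R :: 'a monoid set)) \<and>
     \<not> distributive_lattice (subvariety_lattice (var_R \<or>\<^sub>v dual_variety var_R :: 'a monoid set))"
proof (intro conjI, goal_cases)
  case 1
  show ?case using carrier_L_eq[OF assms] by (simp only: list.set)
next
  case 2
  show ?case by (rule distinct_subvarieties[OF assms])
next
  case 3
  show ?case unfolding covering_pairs[OF assms] hasse_edges_def by simp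
next
  case 4
  show ?case using modular_L[OF assms] by (simp add: modular_lattice_def)
next
  case 5
  show ?case by (rule modular_L[OF assms])
next
  case 6
  show ?case by (rule not_distributive_L[OF assms])
qed

end
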